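(* (1) For each $\beta\in\{13,57\}$ there exists an extremal binary self-dual $[66,33,12]$ code with weight enumerator $W_{66,1}$ with parameter $\beta$. (2) For each $\beta\in\{24,25,26,27,39,40,41,42\}$ there exists an extremal binary self-dual $[66,33,12]$ code with weight enumerator $W_{66,3}$ with parameter $\beta$.
   Context: A binary $[n,k,d]$ code is a $k$-dimensional subspace of $\mathbb{F}_2^n$ with minimum Hamming distance $d$; it is self-dual if it equals its dual with respect to the standard inner product. A binary self-dual code of length $n$ has minimum distance $d\le 4\lfloor n/24\rfloor+6$ if $n\equiv 22\pmod{24}$ and $d\le 4\lfloor n/24\rfloor+4$ otherwise, and it is called extremal if it meets this bound; for $n=66$ this means $d=12$. The weight enumerator of a binary code is $\sum_i A_iy^i$, where $A_i$ is the number of codewords of Hamming weight $i$. A self-dual $[66,33,12]$ binary code has a weight enumerator of one of the forms $W_{66,1}=1+(858+8\beta)y^{12}+(18678-24\beta)y^{14}+\cdots$ with $0\le\beta\le 778$, $W_{66,2}=1+1690y^{12}+7990y^{14}+\cdots$, or $W_{66,3}=1+(858+8\beta)y^{12}+(18166-24\beta)y^{14}+\cdots$ with $14\le\beta\le 756$. Having weight enumerator $W_{66,1}$ (resp. $W_{66,3}$) with parameter $\beta$ means that the numbers of codewords of weights $12$ and $14$ are the displayed coefficients for that $\beta$. *)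

theory Defs
  imports
    "HOL-Analysis.Analysis"
    "HOL-Library.Z2"
    "HOL-Computational_Algebra.Polynomial"
begin

text \<open>
  Type \<open>bit\<close> is the field with two elements, so \<open>bit ^ 'n\<close> is the space of binary words
  of length \<open>CARD('n)\<close>.
\<close>

definition hamming_weight :: "bit ^ 'n \<Rightarrow> nat" where
  "hamming_weight x = card {i. x $ i \<noteq> 0}"

definition hamming_distance :: "bit ^ 'n \<Rightarrow> bit ^ 'n \<Rightarrow> nat" where
  "hamming_distance x y = card {i. x $ i \<noteq> y $ i}"

text \<open>Only meaningful for codes with at least two codewords (\<open>Min {}\<close> is unspecified).\<close>

definition min_distance :: "(bit ^ 'n) set \<Rightarrow> nat" where
  "min_distance C = Min {hamming_distance x y | x y. x \<in> C \<and> y \<in> C \<and> x \<noteq> y}"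

text \<open>\<open>binary_code k d C\<close>: \<open>C\<close> is a binary [\<open>n\<close>, \<open>k\<close>, \<open>d\<close>] code, with \<open>n\<close> given by the type.\<close>

definition binary_code :: "nat \<Rightarrow> nat \<Rightarrow> (bit ^ 'n) set \<Rightarrow> bool" where
  "binary_code k d C \<longleftrightarrow> vec.subspace C \<and> vec.dim C = k \<and> min_distance C = d"

definition dual_code :: "(bit ^ 'n) set \<Rightarrow> (bit ^ 'n) set" where
  "dual_code C = {x. \<forall>c\<in>C. scalar_product x c = 0}"

definition self_dual :: "(bit ^ 'n) set \<Rightarrow> bool" where
  "self_dual C \<longleftrightarrow> C = dual_code C"

definition extremal_distance :: "nat \<Rightarrow> nat" where
  "extremal_distance n = (if n mod 24 = 22 then 4 * (n div 24) + 6 else 4 * (n div 24) + 4)"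

definition extremal_self_dual :: "(bit ^ 'n) set \<Rightarrow> bool" where
  "extremal_self_dual C \<longleftrightarrow> self_dual C \<and> min_distance C = extremal_distance CARD('n)"

definition weight_enumerator :: "(bit ^ 'n) set \<Rightarrow> nat poly" where
  "weight_enumerator C = (\<Sum>i\<le>CARD('n). monom (card {c \<in> C. hamming_weight c = i}) i)"

text \<open>
  Having weight enumerator \<open>W\<^sub>6\<^sub>6\<^sub>,\<^sub>1\<close> or \<open>W\<^sub>6\<^sub>6\<^sub>,\<^sub>3\<close> with parameter \<open>\<beta>\<close> prescribes the coefficients of
  \<open>y\<close> to the powers 12 and 14. They are compared as integers because of the subtraction.
\<close>

definition has_W66_1 :: "int \<Rightarrow> (bit ^ 66) set \<Rightarrow> bool" where
  "has_W66_1 \<beta> C \<longleftrightarrow>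
     int (coeff (weight_enumerator C) 12) = 858 + 8 * \<beta> \<and>
     int (coeff (weight_enumerator C) 14) = 18678 - 24 * \<beta>"

definition has_W66_3 :: "int \<Rightarrow> (bit ^ 66) set \<Rightarrow> bool" where
  "has_W66_3 \<beta> C \<longleftrightarrow>
     int (coeff (weight_enumerator C) 12) = 858 + 8 * \<beta> \<and>
     int (coeff (weight_enumerator C) 14) = 18166 - 24 * \<beta>"

end

theory Submission
  imports Defs
begin

text \<open>
  Let \<open>C\<close> be self-dual of length 66 and let \<open>s\<close> satisfy \<open>s \<cdot> c = wt(c) / 2\<close> modulo 2 for all \<open>c\<close> in \<open>C\<close>.
  The dual of the doubly even subcode of \<open>C\<close> is the union of \<open>C\<close> and the shadow \<open>s + C\<close>. If \<open>C\<close> has no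
  nonzero word of weight at most 10, then, since \<open>C\<close> contains the all-one word, the doubly even
  subcode only has the weights 0, 12, 16, ..., 52, and its MacWilliams identities for the dual
  weights 0, ..., 10 determine its weight distribution. In particular the numbers of words
  of weight 12 and of weight 14 = 66 - 52 in \<open>C\<close> are known once the words of weight at most 9 in the
  shadow have been counted, so that only very light words have to be enumerated.

  The codes are \<open>{(u, uA)}\<close> for orthogonal 33 by 33 matrices \<open>A\<close>, and a light word has few ones in
  one of its halves. The light sums of few rows of \<open>A\<close> are found by a meet in the middle: the sums
  over the first 16 rows and over the last 17 rows are stored in tries, which are descended
  simultaneously with a bound on the number of disagreements.

  The matrices were found by a computer search among the codes spanned by \<open>(1, 0, x)\<close> and
  \<open>(x \<cdot> c, x \<cdot> c, c)\<close>, \<open>c\<close> in \<open>C'\<close>, for extremal self-dual codes \<open>C'\<close> of length 64: four-circulant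
  ones for the first family, and ones with an automorphism of order 15 and a shadow vector of
  weight 4 for the second.
\<close>

subsection \<open>The MacWilliams identities of the doubly even subcode\<close>

lemma bit_add_self [simp]: "x + x = (0 :: bit)"
  by (cases x) auto

lemma bit_neq_0: "x \<noteq> (0 :: bit) \<longleftrightarrow> x = 1"
  by (cases x) auto

lemma word_add_self [simp]: "x + x = (0 :: bit ^ 'n)"
  by (simp add: vec_eq_iff del: add_bit_eq_xor)

text \<open>The nontrivial additive character of the field with two elements, with integer
  values.\<close>

definition sign :: "bit \<Rightarrow> int" where
  "sign b = (if b = 0 then 1 else - 1)"

lemma sign_add: "sign (a + b) = sign a * sign b"
  by (cases a; cases b) (auto simp: sign_def)

lemma scalar_product_add_left: "scalar_product (x + y) z = scalar_product x z + scalar_product y z"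
  for x y z :: "bit ^ 'n"
  by (simp only: scalar_product_def vector_add_component distrib_right sum.distrib)

lemma scalar_product_add_right: "scalar_product z (x + y) = scalar_product z x + scalar_product z y"
  for x y z :: "bit ^ 'n"
  by (simp only: scalar_product_def vector_add_component distrib_left sum.distrib)

lemma scalar_product_zero [simp]: "scalar_product 0 x = (0::bit)" "scalar_product x 0 = (0::bit)"
  by (simp_all add: scalar_product_def)

text \<open>Counted as a natural number, so that it serves both for inner products modulo 2 and for
  weights modulo 4.\<close>

definition overlap :: "bit ^ 'n \<Rightarrow> bit ^ 'n \<Rightarrow> nat" where
  "overlap x y = card {i. x $ i \<noteq> 0 \<and> y $ i \<noteq> 0}"

lemma of_nat_bit_eq_0_iff: "of_nat n = (0::bit) \<longleftrightarrow> even n"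
  by (induction n) (auto simp: bit_neq_0)

lemma scalar_product_eq_overlap: "scalar_product x y = of_nat (overlap x y)" for x y :: "bit ^ 'n"
proof -
  have "scalar_product x y = (\<Sum>i\<in>UNIV. if x $ i \<noteq> 0 \<and> y $ i \<noteq> 0 then 1 else 0)"
    unfolding scalar_product_def by (intro sum.cong) auto
  also have "\<dots> = of_nat (overlap x y)"
    by (simp add: sum.If_cases overlap_def)
  finally show ?thesis .
qed

lemma scalar_product_eq_0_iff: "scalar_product x y = 0 \<longleftrightarrow> even (overlap x y)"
  for x y :: "bit ^ 'n"
  by (simp add: scalar_product_eq_overlap of_nat_bit_eq_0_iff)

lemma overlap_self: "overlap x x = hamming_weight x"
  by (simp add: overlap_def hamming_weight_def)

text \<open>The support of a sum is the symmetric difference of the supports. The additive form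
  avoids truncated subtraction.\<close>

lemma hamming_weight_add:
  "hamming_weight (x + y) + 2 * overlap x y = hamming_weight x + hamming_weight y"
proof -
  let ?A = "{i. x $ i \<noteq> 0}" and ?B = "{i. y $ i \<noteq> 0}"
  have "{i. (x + y) $ i \<noteq> 0} = (?A - ?B) \<union> (?B - ?A)"
    by (auto simp: bit_neq_0 simp del: add_bit_eq_xor) 
  then have "hamming_weight (x + y) = card (?A - ?B) + card (?B - ?A)"
    unfolding hamming_weight_def by (simp add: card_Un_disjoint Diff_Int_distrib2 disjoint_iff)
  moreover have "card (?A - ?B) + card (?A \<inter> ?B) = card ?A"
    by (metis add.commute card_Int_Diff finite)
  moreover have "card (?B - ?A) + card (?A \<inter> ?B) = card ?B"
    by (metis Int_commute add.commute card_Int_Diff finite)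
  moreover have "?A \<inter> ?B = {i. x $ i \<noteq> 0 \<and> y $ i \<noteq> 0}" by auto
  ultimately show ?thesis
    by (simp add: overlap_def hamming_weight_def)
qed

lemma hamming_distance_eq: "hamming_distance x y = hamming_weight (x + y)"
  for x y :: "bit ^ 'n"
proof -
  have "x $ i \<noteq> y $ i \<longleftrightarrow> (x + y) $ i \<noteq> 0" for i
    by (cases "x $ i"; cases "y $ i") auto
  then show ?thesis by (simp add: hamming_distance_def hamming_weight_def)
qed

lemma hamming_weight_le: "hamming_weight (x :: bit ^ 'n) \<le> CARD('n)"
  by (simp add: hamming_weight_def card_mono)

lemma hamming_weight_eq_0_iff: "hamming_weight x = 0 \<longleftrightarrow> x = 0"
  by (auto simp: hamming_weight_def vec_eq_iff)

lemma hamming_weight_complement: "hamming_weight (1 + x) + hamming_weight x = CARD('n)"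
  for x :: "bit ^ 'n"
proof -
  have "{i. (1 + x) $ i \<noteq> 0} = - {i. x $ i \<noteq> 0}"
    by (auto simp: bit_neq_0 simp del: add_bit_eq_xor)
  then have "hamming_weight (1 + x) = CARD('n) - hamming_weight x"
    by (simp add: hamming_weight_def Compl_eq_Diff_UNIV card_Diff_subset)
  then show ?thesis using hamming_weight_le[of x] by simp
qed

text \<open>The binary Krawtchouk polynomial of degree \<open>j\<close> for length \<open>n\<close>,
  evaluated at \<open>w\<close>.\<close>

definition krawtchouk :: "nat \<Rightarrow> nat \<Rightarrow> nat \<Rightarrow> int" where
  "krawtchouk n j w = (\<Sum>i\<le>j. (- 1) ^ i * int (w choose i) * int ((n - w) choose (j - i)))"

section \<open>Character sums over the words of a fixed weight and over a code\<close>

definition support :: "bit ^ 'n \<Rightarrow> 'n set" where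
  "support x = {i. x $ i \<noteq> 0}"

lemma hamming_weight_support: "hamming_weight x = card (support x)"
  by (simp add: hamming_weight_def support_def)

lemma support_inj: "support x = support y \<longleftrightarrow> x = y"
  by (auto simp: support_def vec_eq_iff set_eq_iff bit_neq_0) (metis bit_neq_0)

lemma support_indicator: "support (\<chi> i. of_bool (i \<in> T)) = T"
  by (auto simp: support_def)

lemma bij_support: "bij_betw support (UNIV :: (bit ^ 'n) set) UNIV"
  by (rule bij_betwI[where g = "\<lambda>T. \<chi> i. of_bool (i \<in> T)"])
     (auto simp: support_indicator support_inj[symmetric])

lemma finite_words [simp]: "finite (A :: (bit ^ 'n) set)"
  using bij_betw_finite[OF bij_support] by (metis finite finite_subset subset_UNIV)

text \<open>A set \<open>T\<close> is determined by its parts inside and outside \<open>S\<close>.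
  The assumption guards the truncated difference \<open>j - i\<close>.\<close>

lemma card_split_subsets:
  fixes S :: "'a :: finite set"
  assumes "i \<le> j"
  shows "card {T. card T = j \<and> card (T \<inter> S) = i} = (card S choose i) * ((CARD('a) - card S) choose (j - i))"
proof -
  have "bij_betw (\<lambda>T. (T \<inter> S, T - S)) {T. card T = j \<and> card (T \<inter> S) = i}
     ({A. A \<subseteq> S \<and> card A = i} \<times> {B. B \<subseteq> - S \<and> card B = j - i})"
  proof (rule bij_betwI[where g = "\<lambda>(A, B). A \<union> B"])
    show "(\<lambda>T. (T \<inter> S, T - S)) \<in> {T. card T = j \<and> card (T \<inter> S) = i} \<rightarrow>
        {A. A \<subseteq> S \<and> card A = i} \<times> {B. B \<subseteq> - S \<and> card B = j - i}"
      by (auto simp: card_Diff_subset_Int)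
    have "card (A \<union> B) = j \<and> card ((A \<union> B) \<inter> S) = i"
      if "A \<subseteq> S" "card A = i" "B \<subseteq> - S" "card B = j - i" for A B
    proof -
      have "(A \<union> B) \<inter> S = A" "A \<inter> B = {}" using that by auto
      then show ?thesis using that assms by (simp add: card_Un_disjoint)
    qed
    then show "(\<lambda>(A, B). A \<union> B) \<in> {A. A \<subseteq> S \<and> card A = i} \<times> {B. B \<subseteq> - S \<and> card B = j - i}
      \<rightarrow> {T. card T = j \<and> card (T \<inter> S) = i}" by auto
  qed auto
  then have "card {T. card T = j \<and> card (T \<inter> S) = i} =
      card {A. A \<subseteq> S \<and> card A = i} * card {B. B \<subseteq> - S \<and> card B = j - i}"
    by (simp add: bij_betw_same_card card_cartesian_product)
  then show ?thesis by (simp add: n_subsets Compl_eq_Diff_UNIV card_Diff_subset)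
qed

text \<open>The words of weight \<open>j\<close> are grouped by the number \<open>i\<close> of ones
  they share with \<open>c\<close>; each contributes (-1) to the power \<open>i\<close>.\<close>

lemma sum_sign_fixed_weight:
  fixes c :: "bit ^ 'n"
  shows "(\<Sum>v | hamming_weight v = j. sign (scalar_product v c)) =
    krawtchouk CARD('n) j (hamming_weight c)"
proof -
  have bij: "bij_betw support {v :: bit ^ 'n. hamming_weight v = j} {T. card T = j}"
  proof (rule bij_betw_subset[OF bij_support])
    have "T \<in> support ` {v. hamming_weight v = j}" if "card T = j" for T :: "'n set"
      using that by (intro image_eqI[of _ _ "\<chi> i. of_bool (i \<in> T)"])
        (simp_all add: support_indicator hamming_weight_support)
    then show "support ` {v :: bit ^ 'n. hamming_weight v = j} = {T. card T = j}"
      by (auto simp: hamming_weight_support)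
  qed simp
  have "sign (scalar_product v c) = (- 1) ^ card (support v \<inter> support c)" for v
    by (auto simp: sign_def scalar_product_eq_0_iff overlap_def support_def Collect_conj_eq)
  then have "(\<Sum>v | hamming_weight v = j. sign (scalar_product v c)) =
      (\<Sum>v | hamming_weight v = j. (- 1) ^ card (support v \<inter> support c))" by simp
  also have "\<dots> = (\<Sum>T | card T = j. (- 1) ^ card (T \<inter> support c))"
    by (rule sum.reindex_bij_betw[OF bij])
  also have "\<dots> = (\<Sum>i\<le>j. \<Sum>T | card T = j \<and> card (T \<inter> support c) = i. (- 1) ^ card (T \<inter> support c))"
  proof (subst sum.group[symmetric, where T = "{..j}" and g = "\<lambda>T. card (T \<inter> support c)"])
    show "(\<lambda>T. card (T \<inter> support c)) ` {T. card T = j} \<subseteq> {..j}"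
      by (auto intro: card_mono)
  qed auto
  also have "\<dots> = (\<Sum>i\<le>j. (- 1) ^ i * int (card {T. card T = j \<and> card (T \<inter> support c) = i}))"
    by (intro sum.cong) auto
  also have "\<dots> = krawtchouk CARD('n) j (hamming_weight c)"
    unfolding krawtchouk_def
    by (intro sum.cong) (auto simp: card_split_subsets hamming_weight_def support_def)
  finally show ?thesis .
qed

text \<open>Orthogonality of characters: if some \<open>d\<close> in \<open>C\<close> has odd inner
  product with \<open>v\<close>, translation by \<open>d\<close> permutes \<open>C\<close> and
  negates the sum.\<close>

lemma sum_sign_code:
  fixes C :: "(bit ^ 'n) set"
  assumes add: "\<And>x y. x \<in> C \<Longrightarrow> y \<in> C \<Longrightarrow> x + y \<in> C"
  shows "(\<Sum>c\<in>C. sign (scalar_product v c)) = (if v \<in> dual_code C then int (card C) else 0)"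
proof (cases "v \<in> dual_code C")
  case True
  then have "(\<Sum>c\<in>C. sign (scalar_product v c)) = (\<Sum>c\<in>C. 1)"
    by (intro sum.cong) (auto simp: dual_code_def sign_def)
  with True show ?thesis by simp
next
  case False
  then obtain d where d: "d \<in> C" "scalar_product v d \<noteq> 0" by (auto simp: dual_code_def)
  have bij: "bij_betw (\<lambda>c. c + d) C C"
    by (rule bij_betwI[where g = "\<lambda>c. c + d"]) (auto simp: add d add.assoc)
  have "(\<Sum>c\<in>C. sign (scalar_product v c)) = (\<Sum>c\<in>C. sign (scalar_product v (c + d)))"
    by (rule sum.reindex_bij_betw[OF bij, symmetric])
  also have "\<dots> = - (\<Sum>c\<in>C. sign (scalar_product v c))"
    using d by (simp add: scalar_product_add_right sign_add sum_negf[symmetric] del: add_bit_eq_xor)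
       (simp add: sign_def)
  finally show ?thesis using False by simp
qed

text \<open>Adding the characters of \<open>v\<close> and \<open>v + s\<close> leaves twice the
  character of \<open>v\<close> on the doubly even subcode and cancels elsewhere. Summing over all
  \<open>v\<close> of weight \<open>j\<close> and over \<open>C\<close> in both orders gives the two
  sides.\<close>

lemma doubly_even_macwilliams:
  fixes C :: "(bit ^ 'n) set" and s :: "bit ^ 'n"
  assumes add: "\<And>x y. x \<in> C \<Longrightarrow> y \<in> C \<Longrightarrow> x + y \<in> C"
    and sd: "self_dual C"
    and shadow: "\<And>c. c \<in> C \<Longrightarrow> scalar_product s c = 0 \<longleftrightarrow> 4 dvd hamming_weight c"
  shows "2 * (\<Sum>c | c \<in> C \<and> 4 dvd hamming_weight c. krawtchouk CARD('n) j (hamming_weight c)) =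
    int (card C) * (int (card {v \<in> C. hamming_weight v = j}) +
                    int (card {v. v + s \<in> C \<and> hamming_weight v = j}))"
proof -
  let ?V = "{v :: bit ^ 'n. hamming_weight v = j}"
  have dual: "dual_code C = C" using sd by (simp add: self_dual_def)
  \<comment> \<open>The shadow vector changes the sign exactly at the words whose weight is not
    divisible by 4.\<close>
  have sg: "sign (scalar_product (v + s) c) =
      sign (scalar_product v c) * (if 4 dvd hamming_weight c then 1 else - 1)" if "c \<in> C" for v c
    using shadow[OF that] by (simp add: scalar_product_add_left sign_add del: add_bit_eq_xor) (simp add: sign_def)
  have vals: "(\<Sum>c\<in>C. sign (scalar_product v c)) + (\<Sum>c\<in>C. sign (scalar_product (v + s) c)) =
      int (card C) * (of_bool (v \<in> C) + of_bool (v + s \<in> C))" for v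
    by (auto simp: sum_sign_code[OF add] dual of_bool_def)
  have "(\<Sum>v\<in>?V. (\<Sum>c\<in>C. sign (scalar_product v c)) + (\<Sum>c\<in>C. sign (scalar_product (v + s) c))) =
     (\<Sum>v\<in>?V. \<Sum>c\<in>C. (if 4 dvd hamming_weight c then 2 * sign (scalar_product v c) else 0))"
    by (intro sum.cong refl) (auto simp: sum.distrib[symmetric] sg intro!: sum.cong)
  also have "\<dots> = (\<Sum>c\<in>C. if 4 dvd hamming_weight c then 2 * (\<Sum>v\<in>?V. sign (scalar_product v c)) else 0)"
    by (subst sum.swap) (auto simp: sum_distrib_left intro!: sum.cong)
  also have "\<dots> = 2 * (\<Sum>c | c \<in> C \<and> 4 dvd hamming_weight c. krawtchouk CARD('n) j (hamming_weight c))"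
    by (simp add: sum_sign_fixed_weight sum_distrib_left sum.If_cases Collect_conj_eq)
  finally have "2 * (\<Sum>c | c \<in> C \<and> 4 dvd hamming_weight c. krawtchouk CARD('n) j (hamming_weight c)) =
     (\<Sum>v\<in>?V. int (card C) * (of_bool (v \<in> C) + of_bool (v + s \<in> C)))"
    by (simp only: vals)
  also have "\<dots> = int (card C) * (\<Sum>v\<in>?V. of_bool (v \<in> C) + of_bool (v + s \<in> C))"
    by (simp add: sum_distrib_left)
  also have "(\<Sum>v\<in>?V. of_bool (v \<in> C) + of_bool (v + s \<in> C)) =
      int (card {v \<in> C. hamming_weight v = j}) + int (card {v. v + s \<in> C \<and> hamming_weight v = j})"
    by (simp add: sum.distrib sum_of_bool_eq Collect_conj_eq Int_commute)
  finally show ?thesis .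
qed

subsection \<open>Systematic self-dual codes\<close>

declare add_bit_eq_xor [simp del] mult_bit_eq_and [simp del]

lemma hamming_weight_eq_sum: "hamming_weight x = (\<Sum>k\<in>UNIV. of_bool (x $ k \<noteq> 0))" for x :: "bit ^ 'n"
  by (simp add: hamming_weight_def sum_of_bool_eq)

text \<open>Turns a product of a vector with a matrix into the sum of the selected rows, the form in
  which sums are enumerated.\<close>

lemma sum_if_bit: "finite A \<Longrightarrow> (\<Sum>i\<in>A. x i * f i) = (\<Sum>i | i \<in> A \<and> x i \<noteq> 0. f i)"
  for x f :: "'a \<Rightarrow> bit"
  by (rule sum.mono_neutral_cong_right) (auto simp: bit_neq_0)

text \<open>The functions \<open>l\<close> and \<open>r\<close> number the coordinates of the two
  halves, and \<open>rows\<close> and \<open>cols\<close> state that the matrix A with entries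
  \<open>a i j\<close> is orthogonal on both sides.\<close>

locale systematic_code =
  fixes l r :: "nat \<Rightarrow> 'n :: finite" and m :: nat and a :: "nat \<Rightarrow> nat \<Rightarrow> bit"
  assumes inj_l: "inj_on l {..<m}" and inj_r: "inj_on r {..<m}"
    and disj: "l ` {..<m} \<inter> r ` {..<m} = {}" and cover: "l ` {..<m} \<union> r ` {..<m} = UNIV"
    and rows: "i < m \<Longrightarrow> i' < m \<Longrightarrow> (\<Sum>j<m. a i j * a i' j) = of_bool (i = i')"
    and cols: "j < m \<Longrightarrow> j' < m \<Longrightarrow> (\<Sum>i<m. a i j * a i j') = of_bool (j = j')"
begin

definition word :: "(nat \<Rightarrow> bit) \<Rightarrow> (nat \<Rightarrow> bit) \<Rightarrow> bit ^ 'n" where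
  "word u v = (\<chi> k. if k \<in> l ` {..<m} then u (inv_into {..<m} l k) else v (inv_into {..<m} r k))"

lemma word_l [simp]: "i < m \<Longrightarrow> word u v $ l i = u i"
  using inj_l by (simp add: word_def)

lemma word_r [simp]: "j < m \<Longrightarrow> word u v $ r j = v j"
  using inj_r disj by (auto simp: word_def)

lemma sum_split: "(\<Sum>k\<in>UNIV. f k) = (\<Sum>i<m. f (l i)) + (\<Sum>j<m. f (r j))"
  by (simp add: cover[symmetric] sum.union_disjoint disj sum.reindex inj_l inj_r)

lemma word_eqI: "(\<And>i. i < m \<Longrightarrow> x $ l i = y $ l i) \<Longrightarrow> (\<And>j. j < m \<Longrightarrow> x $ r j = y $ r j) \<Longrightarrow> x = y"
  using cover by (auto simp: vec_eq_iff set_eq_iff image_iff) (metis lessThan_iff)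

lemma weight_split:
  "hamming_weight x = card {i. i < m \<and> x $ l i \<noteq> 0} + card {j. j < m \<and> x $ r j \<noteq> 0}" for x :: "bit ^ 'n"
  by (simp add: hamming_weight_eq_sum sum_split sum_of_bool_eq Collect_conj_eq lessThan_def Int_commute)

text \<open>The row space of (I | A), given by the parity checks that make the right half the
  product of the left half with A.\<close>

definition code :: "(bit ^ 'n) set" where
  "code = {x. \<forall>j<m. x $ r j = (\<Sum>i<m. x $ l i * a i j)}"

text \<open>Multiply v = uA on the right by the transpose of A.\<close>

lemma invert:
  assumes "\<And>j. j < m \<Longrightarrow> v j = (\<Sum>i<m. u i * a i j)" "i < m"
  shows "u i = (\<Sum>j<m. v j * a i j)"
proof -
  have "(\<Sum>j<m. v j * a i j) = (\<Sum>j<m. \<Sum>k<m. u k * (a k j * a i j))"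
    using assms by (intro sum.cong) (auto simp: sum_distrib_right mult.assoc)
  also have "\<dots> = (\<Sum>k<m. u k * (\<Sum>j<m. a k j * a i j))"
    by (subst sum.swap) (simp only: sum_distrib_left)
  also have "\<dots> = (\<Sum>k<m. if k = i then u k else 0)"
    using assms by (intro sum.cong) (auto simp: rows)
  also have "\<dots> = u i" using assms by simp
  finally show ?thesis by simp
qed

lemma invert':
  assumes "\<And>i. i < m \<Longrightarrow> u i = (\<Sum>j<m. v j * a i j)" "j < m"
  shows "v j = (\<Sum>i<m. u i * a i j)"
proof -
  have "(\<Sum>i<m. u i * a i j) = (\<Sum>i<m. \<Sum>k<m. v k * (a i k * a i j))"
    using assms by (intro sum.cong) (auto simp: sum_distrib_right mult.assoc)
  also have "\<dots> = (\<Sum>k<m. v k * (\<Sum>i<m. a i k * a i j))"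
    by (subst sum.swap) (simp only: sum_distrib_left)
  also have "\<dots> = (\<Sum>k<m. if k = j then v k else 0)"
    using assms by (intro sum.cong) (auto simp: cols)
  also have "\<dots> = v j" using assms by simp
  finally show ?thesis by simp
qed

text \<open>The right half can serve as the information part as well, with the transpose of A in
  place of A. Words with few ones on the right are treated this way.\<close>

lemma code_iff_left: "x \<in> code \<longleftrightarrow> (\<forall>i<m. x $ l i = (\<Sum>j<m. x $ r j * a i j))"
proof
  assume "x \<in> code"
  then have *: "x $ r j = (\<Sum>i<m. x $ l i * a i j)" if "j < m" for j
    using that unfolding code_def by blast
  show "\<forall>i<m. x $ l i = (\<Sum>j<m. x $ r j * a i j)"
    using invert[where v = "\<lambda>j. x $ r j" and u = "\<lambda>i. x $ l i", OF *] by blast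
next
  assume *: "\<forall>i<m. x $ l i = (\<Sum>j<m. x $ r j * a i j)"
  show "x \<in> code" unfolding code_def
    using invert'[where u = "\<lambda>i. x $ l i" and v = "\<lambda>j. x $ r j"] * by blast
qed

lemma scalar_product_split:
  "scalar_product x y = (\<Sum>i<m. x $ l i * y $ l i) + (\<Sum>j<m. x $ r j * y $ r j)"
  unfolding scalar_product_def by (rule sum_split)

text \<open>Row \<open>i\<close> of the generator matrix (I | A).\<close>

definition generator :: "nat \<Rightarrow> bit ^ 'n" where
  "generator i = word (\<lambda>k. of_bool (k = i)) (a i)"

lemma generator_in_code: "i < m \<Longrightarrow> generator i \<in> code"
  by (auto simp: code_def generator_def sum.delta of_bool_def if_distrib[of "\<lambda>x. x * _"] cong: if_cong)

lemma scalar_product_generator: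
  "i < m \<Longrightarrow> scalar_product x (generator i) = x $ l i + (\<Sum>j<m. x $ r j * a i j)"
  by (simp add: scalar_product_split generator_def of_bool_def if_distrib[of "\<lambda>x. _ * x"] cong: if_cong)

lemma bit_add_eq_0_iff: "x + y = 0 \<longleftrightarrow> x = (y :: bit)"
  by (cases x; cases y) auto

text \<open>Orthogonality to the generators is the equation u = v times the transpose of A.
  Conversely A preserves inner products, so the contributions of the two halves agree and cancel in
  characteristic 2.\<close>

lemma code_dual: "dual_code code = code"
proof
  show "dual_code code \<subseteq> code"
  proof
    fix x assume x: "x \<in> dual_code code"
    have "x $ l i = (\<Sum>j<m. x $ r j * a i j)" if "i < m" for i
    proof -
      have "scalar_product x (generator i) = 0"
        using x generator_in_code[OF that] by (simp add: dual_code_def)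
      then show ?thesis
        using that by (simp only: scalar_product_generator bit_add_eq_0_iff)
    qed
    then show "x \<in> code" by (simp add: code_iff_left)
  qed
  show "code \<subseteq> dual_code code"
  proof
    fix x assume x: "x \<in> code"
    have "scalar_product x y = 0" if y: "y \<in> code" for y
    proof -
      have "(\<Sum>j<m. x $ r j * y $ r j) = (\<Sum>j<m. \<Sum>i<m. x $ l i * (y $ r j * a i j))"
        using x by (intro sum.cong) (auto simp: code_def sum_distrib_right sum_distrib_left mult_ac)
      also have "\<dots> = (\<Sum>i<m. x $ l i * (\<Sum>j<m. y $ r j * a i j))"
        by (subst sum.swap) (simp only: sum_distrib_left)
      also have "\<dots> = (\<Sum>i<m. x $ l i * y $ l i)"
        using y by (intro sum.cong) (auto simp: code_iff_left)
      finally show ?thesis by (simp only: scalar_product_split bit_add_self)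
    qed
    then show "x \<in> dual_code code" by (simp add: dual_code_def)
  qed
qed

lemma self_dual_code: "self_dual code"
  by (simp add: self_dual_def code_dual)

lemma code_add: "x \<in> code \<Longrightarrow> y \<in> code \<Longrightarrow> x + y \<in> code"
  by (simp add: code_def distrib_right sum.distrib)

lemma zero_in_code: "0 \<in> code"
  by (simp add: code_def)

lemma subspace_code: "vec.subspace code"
proof (rule vec.subspaceI)
  fix c x assume "x \<in> code"
  then show "c *s x \<in> code" by (cases c) (auto simp: zero_in_code)
qed (simp_all add: zero_in_code code_add)

text \<open>Encoding is an injective linear map from the words supported on the left half onto the
  code.\<close>

lemma dim_code: "vec.dim code = m"
proof -
  define P where "P = {x :: bit ^ 'n. \<forall>k. k \<notin> l ` {..<m} \<longrightarrow> x $ k = 0}"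
  define f where "f x = word (\<lambda>i. x $ l i) (\<lambda>j. \<Sum>i<m. x $ l i * a i j)" for x :: "bit ^ 'n"
  have lin: "Vector_Spaces.linear (*s) (*s) f"
    unfolding Vector_Spaces.linear_iff
  proof (intro conjI allI vec.vector_space_axioms)
    show "f (x + y) = f x + f y" for x y
      by (rule word_eqI) (simp_all add: f_def sum.distrib distrib_right)
    show "f (c *s x) = c *s f x" for c x
      by (rule word_eqI) (simp_all add: f_def sum_distrib_left mult.assoc)
  qed
  have inj: "inj_on f P"
  proof (rule inj_onI)
    fix x y assume xy: "x \<in> P" "y \<in> P" "f x = f y"
    show "x = y"
    proof (rule word_eqI)
      fix i assume "i < m"
      moreover have "f x $ l i = f y $ l i" using xy(3) by simp
      ultimately show "x $ l i = y $ l i" by (simp add: f_def)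
    next
      fix j assume "j < m"
      then have "r j \<notin> l ` {..<m}" using disj by auto
      then show "x $ r j = y $ r j" using xy by (simp add: P_def)
    qed
  qed
  have P: "vec.span P = P"
    unfolding vec.span_eq_iff by (auto simp: vec.subspace_def P_def)
  have "f ` P = code"
  proof
    show "f ` P \<subseteq> code" by (auto simp: f_def code_def)
    show "code \<subseteq> f ` P"
    proof
      fix x assume x: "x \<in> code"
      have "x = f (word (\<lambda>i. x $ l i) (\<lambda>j. 0))"
        by (rule word_eqI) (use x in \<open>auto simp: f_def code_def\<close>)
      moreover have "word (\<lambda>i. x $ l i) (\<lambda>j. 0) \<in> P" by (auto simp: P_def word_def)
      ultimately show "x \<in> f ` P" by blast
    qed
  qed
  then have "vec.dim code = vec.dim P"
    using vec.dim_image_eq[OF lin] inj P by metis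
  also have "\<dots> = m" unfolding P_def dim_substandard_cart by (simp add: card_image inj_l)
  finally show ?thesis .
qed

text \<open>The inner product of a word with itself is its weight modulo 2.\<close>

lemma even_weight: "x \<in> code \<Longrightarrow> even (hamming_weight x)"
  using code_dual by (auto simp: dual_code_def scalar_product_eq_0_iff overlap_self[symmetric])

lemma code_eqI: "x \<in> code \<Longrightarrow> y \<in> code \<Longrightarrow> (\<And>i. i < m \<Longrightarrow> x $ l i = y $ l i) \<Longrightarrow> x = y"
  by (rule word_eqI) (auto simp: code_def)

text \<open>All weights are even, so the all-one word is orthogonal to the code and lies in its
  dual, which is the code.\<close>

lemma one_in_code: "1 \<in> code"
proof -
  have "scalar_product 1 y = 0" if "y \<in> code" for y
    using even_weight[OF that] by (simp add: scalar_product_eq_0_iff overlap_def hamming_weight_def)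
  then show ?thesis using code_dual by (auto simp: dual_code_def)
qed

text \<open>A codeword is the sum of the generators selected by its left half. This lifts the
  congruence modulo 4 from the rows to the code.\<close>

lemma code_induct [consumes 1, case_names zero step]:
  assumes x: "x \<in> code"
    and zero: "P 0"
    and step: "\<And>x i. x \<in> code \<Longrightarrow> P x \<Longrightarrow> i < m \<Longrightarrow> P (generator i + x)"
  shows "P x"
proof -
  have "P (\<Sum>i\<in>I. generator i) \<and> (\<Sum>i\<in>I. generator i) \<in> code" if "finite I" "I \<subseteq> {..<m}" for I
    using that
    by (induction I rule: finite_induct)
      (auto simp: zero zero_in_code intro!: step code_add generator_in_code)
  note * = this[of "{i. i < m \<and> x $ l i \<noteq> 0}"]
  have "x = (\<Sum>i | i < m \<and> x $ l i \<noteq> 0. generator i)"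
  proof (rule code_eqI[OF x])
    fix k assume "k < m"
    then show "x $ l k = (\<Sum>i | i < m \<and> x $ l i \<noteq> 0. generator i) $ l k"
      by (auto simp: generator_def of_bool_def sum.delta bit_neq_0)
  qed (use * in auto)
  then show ?thesis using * by auto
qed

end

subsection \<open>Shadows\<close>

text \<open>The shadow vector is (0, t). The condition is imposed on the generators only;
  \<open>Suc\<close> counts the single one in the identity part of a row.\<close>

locale shadowed_code = systematic_code l r m a
  for l r :: "nat \<Rightarrow> 'n :: finite" and m :: nat and a :: "nat \<Rightarrow> nat \<Rightarrow> bit" +
  fixes t :: "nat \<Rightarrow> bit"
  assumes shadow_vector: "i < m \<Longrightarrow>
    (\<Sum>j<m. t j * a i j) = 0 \<longleftrightarrow> 4 dvd Suc (card {j. j < m \<and> a i j \<noteq> 0})"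
begin

definition shadow :: "(bit ^ 'n) set" where
  "shadow = {v. v + word (\<lambda>_. 0) t \<in> code}"

text \<open>In a self-dual code weights and overlaps are even, so twice the overlap vanishes modulo
  4 and half the weight is additive modulo 2.\<close>

lemma four_dvd_weight_add:
  assumes "x \<in> code" "y \<in> code"
  shows "4 dvd hamming_weight (x + y) \<longleftrightarrow> (4 dvd hamming_weight x \<longleftrightarrow> 4 dvd hamming_weight y)"
proof -
  have "even (overlap x y)"
    using assms code_dual by (auto simp: dual_code_def scalar_product_eq_0_iff)
  moreover have "even (hamming_weight x)" "even (hamming_weight y)"
    using assms by (auto simp: even_weight)
  ultimately show ?thesis
    using hamming_weight_add[of x y] by presburger
qed

text \<open>Both sides describe additive maps from the code to the field with two elements, and
  these agree on the generators.\<close>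

lemma shadow_scalar_product:
  assumes "c \<in> code"
  shows "scalar_product (word (\<lambda>_. 0) t) c = 0 \<longleftrightarrow> 4 dvd hamming_weight c"
  using assms
proof (induction rule: code_induct)
  case zero
  then show ?case by (simp add: hamming_weight_def)
next
  case (step x i)
  have "{k. k < m \<and> generator i $ l k \<noteq> 0} = {i}"
    and "{j. j < m \<and> generator i $ r j \<noteq> 0} = {j. j < m \<and> a i j \<noteq> 0}"
    using step by (auto simp: generator_def)
  then have "hamming_weight (generator i) = Suc (card {j. j < m \<and> a i j \<noteq> 0})"
    by (simp only: weight_split) simp
  moreover have "scalar_product (word (\<lambda>_. 0) t) (generator i) = (\<Sum>j<m. t j * a i j)"
    using step by (simp add: scalar_product_generator)
  ultimately have "4 dvd hamming_weight (generator i) \<longleftrightarrow> scalar_product (word (\<lambda>_. 0) t) (generator i) = 0"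
    using step shadow_vector[of i] by simp
  moreover have "4 dvd hamming_weight (generator i + x) \<longleftrightarrow>
      (4 dvd hamming_weight (generator i) \<longleftrightarrow> 4 dvd hamming_weight x)"
    using step by (intro four_dvd_weight_add generator_in_code)
  moreover have "u + v = 0 \<longleftrightarrow> (u = 0 \<longleftrightarrow> v = 0)" for u v :: bit
    by (cases u; cases v) auto
  ultimately show ?case
    using step unfolding scalar_product_add_right by blast
qed

lemma shadow_iff_right: "v \<in> shadow \<longleftrightarrow> (\<forall>j<m. v $ r j = t j + (\<Sum>i<m. v $ l i * a i j))"
  (is "_ \<longleftrightarrow> ?R")
proof -
  have "x + y = z \<longleftrightarrow> x = y + z" for x y z :: bit
    by (cases x; cases y; cases z) auto
  then show ?thesis by (simp add: shadow_def code_def)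
qed

lemma shadow_iff_left:
  "v \<in> shadow \<longleftrightarrow> (\<forall>i<m. v $ l i = (\<Sum>j<m. t j * a i j) + (\<Sum>j<m. v $ r j * a i j))"
  by (simp add: shadow_def code_iff_left distrib_right sum.distrib add.commute)

text \<open>The weight of \<open>v\<close> modulo 2 is its inner product with the all-one codeword.
  It equals that of (0, t), which is nonzero because the all-one word is not doubly even.\<close>

lemma odd_weight_shadow:
  assumes "v \<in> shadow" "\<not> 4 dvd CARD('n)"
  shows "odd (hamming_weight v)"
proof -
  let ?s = "word (\<lambda>_. 0) t"
  have wt1: "hamming_weight (1 :: bit ^ 'n) = CARD('n)"
    by (simp add: hamming_weight_def)
  have "scalar_product (v + ?s) 1 = 0"
    using assms code_dual one_in_code by (auto simp: shadow_def dual_code_def)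
  moreover have "scalar_product ?s 1 \<noteq> 0"
    using shadow_scalar_product[OF one_in_code] assms(2) wt1 by simp
  ultimately have "scalar_product v 1 \<noteq> 0"
    by (simp only: scalar_product_add_left bit_add_eq_0_iff) simp
  then show ?thesis
    by (simp add: scalar_product_eq_0_iff overlap_def hamming_weight_def del: bit_not_zero_iff)
qed

lemma card_code: "card code = 2 ^ m"
proof -
  have "bij_betw (\<lambda>x. {i \<in> {..<m}. x $ l i \<noteq> 0}) code (Pow {..<m})"
    unfolding bij_betw_def
  proof
    show "inj_on (\<lambda>x. {i \<in> {..<m}. x $ l i \<noteq> 0}) code"
    proof (rule inj_onI)
      fix x y assume xy: "x \<in> code" "y \<in> code" "{i \<in> {..<m}. x $ l i \<noteq> 0} = {i \<in> {..<m}. y $ l i \<noteq> 0}"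
      have "x $ l i = y $ l i" if "i < m" for i
      proof -
        have "x $ l i \<noteq> 0 \<longleftrightarrow> y $ l i \<noteq> 0" using xy(3) that by blast
        then show ?thesis by (cases "x $ l i"; cases "y $ l i") auto
      qed
      then show "x = y" using xy code_eqI by blast
    qed
    have "I \<in> (\<lambda>x. {i \<in> {..<m}. x $ l i \<noteq> 0}) ` code" if "I \<subseteq> {..<m}" for I
    proof (rule image_eqI)
      let ?u = "\<lambda>i. of_bool (i \<in> I) :: bit"
      show "I = {i \<in> {..<m}. word ?u (\<lambda>j. \<Sum>i<m. ?u i * a i j) $ l i \<noteq> 0}"
        using that by auto
      show "word ?u (\<lambda>j. \<Sum>i<m. ?u i * a i j) \<in> code"
        by (simp add: code_def)
    qed
    then show "(\<lambda>x. {i \<in> {..<m}. x $ l i \<noteq> 0}) ` code = Pow {..<m}"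
      by blast
  qed
  then show ?thesis by (simp add: bij_betw_same_card card_Pow)
qed

lemma macwilliams:
  "2 * (\<Sum>c | c \<in> code \<and> 4 dvd hamming_weight c. krawtchouk CARD('n) j (hamming_weight c)) =
    2 ^ m * (int (card {v \<in> code. hamming_weight v = j}) + int (card {v \<in> shadow. hamming_weight v = j}))"
  using doubly_even_macwilliams[OF code_add self_dual_code shadow_scalar_product, of j]
  by (simp add: card_code shadow_def)

end

section \<open>Krawtchouk interpolation on the doubly even weights\<close>

definition doubly_even_weights :: "nat list" where
  "doubly_even_weights = [12, 16, 20, 24, 28, 32, 36, 40, 44, 48, 52]"

text \<open>The coefficients interpolate: they express, in the basis of Krawtchouk polynomials of degree
  at most 10, the multiples by \<open>2 ^ 30\<close> of the Lagrange polynomials for the weights 12 and 52 on the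
  eleven possible nonzero doubly even weights.\<close>

definition lagrange_12 :: "int list" where
  "lagrange_12 = [286, 208, 130, 52, 40, 28, 16, 4, 3, 2, 1]"

definition lagrange_52 :: "int list" where
  "lagrange_52 = [4686, -2672, 1490, -828, 440, -212, 96, -44, 19, -6, 1]"

definition interpolate :: "int list \<Rightarrow> nat \<Rightarrow> int" where
  "interpolate cs w = (\<Sum>j\<leftarrow>[0..<11]. cs ! j * krawtchouk 66 j w)"

lemma upt_11: "[0..<11] = [0, 1, 2, 3, 4, 5, 6, 7, 8, 9, 10 :: nat]"
  by (simp add: upt_rec)

text \<open>Multiplies a truncated power series by 1 + c z. The argument \<open>y\<close> is the
  preceding coefficient, and keeping the length performs the truncation.\<close>

fun times_linear :: "int \<Rightarrow> int \<Rightarrow> int list \<Rightarrow> int list" where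
  "times_linear c y [] = []"
| "times_linear c y (x # xs) = (x + c * y) # times_linear c x xs"

lemma length_times_linear [simp]: "length (times_linear c y xs) = length xs"
  by (induction xs arbitrary: y) auto

lemma nth_times_linear:
  "j < length xs \<Longrightarrow> times_linear c y xs ! j = xs ! j + c * (case j of 0 \<Rightarrow> y | Suc i \<Rightarrow> xs ! i)"
  by (induction xs arbitrary: j y) (auto simp: nth_Cons split: nat.split)

definition truncation :: "int poly \<Rightarrow> int list" where
  "truncation p = map (coeff p) [0..<11]"

lemma truncation_times_linear: "truncation ([:1, c:] * p) = times_linear c 0 (truncation p)"
  by (rule nth_equalityI) (auto simp: truncation_def nth_times_linear coeff_pCons split: nat.split)

lemma truncation_power: "truncation ([:1, c:] ^ k * p) = (times_linear c 0 ^^ k) (truncation p)"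
  by (induction k) (simp_all only: power_0 power_Suc mult_1_left mult.assoc truncation_times_linear
    funpow_0 funpow.simps comp_apply id_apply)

lemma coeff_linear_power: "coeff ([:1, c:] ^ n) i = of_nat (n choose i) * c ^ i" for c :: "'a :: comm_semiring_1"
proof (cases "i \<le> n")
  case True
  then show ?thesis by (simp add: coeff_linear_poly_power)
next
  case False
  have "degree ([:1, c:] ^ n) \<le> n"
    by (rule order_trans[OF degree_power_le]) simp
  with False show ?thesis by (simp add: coeff_eq_0 binomial_eq_0)
qed

text \<open>The generating function of the Krawtchouk polynomials; it replaces binomial sums by
  repeated multiplication with linear factors.\<close>

lemma krawtchouk_eq_coeff: "krawtchouk n j w = coeff ([:1, -1:] ^ w * [:1, 1:] ^ (n - w)) j"
  by (simp add: krawtchouk_def coeff_mult coeff_linear_power mult.commute)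

lemma truncation_krawtchouk:
  "map (\<lambda>j. krawtchouk n j w) [0..<11] =
    (times_linear (- 1) 0 ^^ w) ((times_linear 1 0 ^^ (n - w)) [1, 0, 0, 0, 0, 0, 0, 0, 0, 0, 0])"
proof -
  have one: "truncation 1 = [1, 0, 0, 0, 0, 0, 0, 0, 0, 0, 0]"
    by (simp add: truncation_def upt_11)
  have "map (\<lambda>j. krawtchouk n j w) [0..<11] = truncation ([:1, -1:] ^ w * ([:1, 1:] ^ (n - w) * 1))"
    by (simp add: truncation_def krawtchouk_eq_coeff)
  then show ?thesis by (simp only: truncation_power one)
qed

lemma interpolate_eq: "interpolate cs w = (\<Sum>(c, k)\<leftarrow>zip cs
    ((times_linear (- 1) 0 ^^ w) ((times_linear 1 0 ^^ (66 - w)) [1, 0, 0, 0, 0, 0, 0, 0, 0, 0, 0])). c * k)"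
  if "length cs = 11"
proof -
  have "zip cs (map f [0..<11]) = map (\<lambda>j. (cs ! j, f j)) [0..<11]" for f :: "nat \<Rightarrow> int"
    by (rule nth_equalityI) (use that in auto)
  then show ?thesis
    by (simp add: truncation_krawtchouk[symmetric] interpolate_def comp_def)
qed

lemma funpow_numeral: "(f ^^ numeral k) x = f ((f ^^ pred_numeral k) x)"
  by (simp add: numeral_eq_Suc)

text \<open>The Lagrange property, scaled by 2 ^ 30 = 1073741824. The first entry is the value at
  weight 0, which is not prescribed and enters the identities as a constant because
  \<open>A 0\<close> is 1.\<close>

lemma interpolate_12:
  "map (interpolate lagrange_12) (0 # doubly_even_weights) =
    [307090161664, 1073741824, 0, 0, 0, 0, 0, 0, 0, 0, 0, 0]"
  by (simp add: lagrange_12_def doubly_even_weights_def interpolate_eq funpow_numeral)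

lemma interpolate_52:
  "map (interpolate lagrange_52) (0 # doubly_even_weights) =
    [70866960384, 0, 0, 0, 0, 0, 0, 0, 0, 0, 0, 1073741824]"
  by (simp add: lagrange_52_def doubly_even_weights_def interpolate_eq funpow_numeral)

section \<open>The numbers of words of weights 12 and 14 in terms of the light shadow words\<close>

locale shadowed_code_66 = shadowed_code l r 33 a t
  for l r :: "nat \<Rightarrow> 66" and a :: "nat \<Rightarrow> nat \<Rightarrow> bit" and t :: "nat \<Rightarrow> bit" +
  assumes light_code: "\<And>x. x \<in> code \<Longrightarrow> hamming_weight x \<le> 10 \<Longrightarrow> x = 0"
begin

text \<open>Adding the all-one word carries the bound from light words to heavy ones: the weights
  56, 60 and 64 would give complements of weights 10, 6 and 2.\<close>

lemma weight_in_code: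
  assumes "c \<in> code" "4 dvd hamming_weight c"
  shows "hamming_weight c \<in> set (0 # doubly_even_weights)"
proof -
  have le: "hamming_weight c \<le> 66" using hamming_weight_le[of c] by simp
  have small: "hamming_weight c = 0 \<or> hamming_weight c > 10"
    using light_code[OF assms(1)] by (auto simp: hamming_weight_eq_0_iff not_le[symmetric])
  have compl: "hamming_weight (1 + c) + hamming_weight c = 66"
    using hamming_weight_complement[of c] by simp
  have "1 + c \<in> code" using assms one_in_code code_add by blast
  then have "hamming_weight (1 + c) = 0 \<or> hamming_weight (1 + c) > 10"
    using light_code by (auto simp: hamming_weight_eq_0_iff not_le[symmetric])
  \<comment> \<open>The value 66 belongs to the all-one word; it drops out next because it is not a
    multiple of 4.\<close>
  then have "hamming_weight c \<le> 55 \<or> hamming_weight c = 66" using compl by linarith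
  moreover obtain k where k: "hamming_weight c = 4 * k" using assms(2) by blast
  ultimately have "k \<le> 13" by presburger
  then have "k \<in> {..13}" by simp
  then show ?thesis using small k by (auto simp: doubly_even_weights_def atMost_nat_numeral)
qed

abbreviation A :: "nat \<Rightarrow> nat" where
  "A w \<equiv> card {c \<in> code. hamming_weight c = w}"

abbreviation B :: "nat \<Rightarrow> nat" where
  "B w \<equiv> card {v \<in> shadow. hamming_weight v = w}"

lemma A_0: "A 0 = 1"
proof -
  have "{c \<in> code. hamming_weight c = 0} = {0}"
    by (auto simp: hamming_weight_eq_0_iff zero_in_code)
  then show ?thesis by simp
qed

lemma A_light: "0 < w \<Longrightarrow> w \<le> 10 \<Longrightarrow> A w = 0"
proof -
  assume w: "0 < w" "w \<le> 10"
  have "hamming_weight c \<noteq> w" if "c \<in> code" for c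
  proof
    assume *: "hamming_weight c = w"
    with that w have "c = 0" using light_code by simp
    with * w show False by (simp add: hamming_weight_def)
  qed
  then show ?thesis by (auto simp: card_eq_0_iff)
qed

lemma sum_doubly_even:
  "(\<Sum>c | c \<in> code \<and> 4 dvd hamming_weight c. f (hamming_weight c)) =
    (\<Sum>w\<leftarrow>0 # doubly_even_weights. int (A w) * f w)"
proof -
  let ?W = "0 # doubly_even_weights"
  have "(\<Sum>c | c \<in> code \<and> 4 dvd hamming_weight c. f (hamming_weight c)) =
     (\<Sum>w\<in>set ?W. \<Sum>c | c \<in> {c \<in> code. 4 dvd hamming_weight c} \<and> hamming_weight c = w. f (hamming_weight c))"
    by (rule sum.group[symmetric]) (use weight_in_code in auto)
  also have "\<dots> = (\<Sum>w\<in>set ?W. int (A w) * f w)"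
  proof (rule sum.cong[OF refl])
    fix w assume "w \<in> set ?W"
    then have "4 dvd w" by (auto simp: doubly_even_weights_def)
    then have "{c. c \<in> {c \<in> code. 4 dvd hamming_weight c} \<and> hamming_weight c = w} = {c \<in> code. hamming_weight c = w}"
      by auto
    then show "(\<Sum>c | c \<in> {c \<in> code. 4 dvd hamming_weight c} \<and> hamming_weight c = w. f (hamming_weight c)) = int (A w) * f w"
      by simp
  qed
  also have "\<dots> = (\<Sum>w\<leftarrow>?W. int (A w) * f w)"
    by (rule sum.distinct_set_conv_list) (simp add: doubly_even_weights_def)
  finally show ?thesis .
qed

text \<open>The MacWilliams identities of degrees 0 to 10 combined with the weights
  \<open>cs\<close>. The factor is half the size 2 ^ 33 of the code, that is, the size of the doubly
  even subcode.\<close>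

lemma interpolate_sum:
  assumes "length cs = 11"
  shows "(\<Sum>w\<leftarrow>0 # doubly_even_weights. int (A w) * interpolate cs w) =
    2 ^ 32 * (\<Sum>j\<leftarrow>[0..<11]. cs ! j * (int (A j) + int (B j)))"
proof -
  have "(\<Sum>w\<leftarrow>0 # doubly_even_weights. int (A w) * interpolate cs w) =
     (\<Sum>c | c \<in> code \<and> 4 dvd hamming_weight c. interpolate cs (hamming_weight c))"
    by (rule sum_doubly_even[symmetric])
  also have "\<dots> = (\<Sum>j\<leftarrow>[0..<11]. cs ! j *
      (\<Sum>c | c \<in> code \<and> 4 dvd hamming_weight c. krawtchouk 66 j (hamming_weight c)))"
    unfolding interpolate_def interv_sum_list_conv_sum_set_nat sum_distrib_left
    by (rule sum.swap)
  also have "\<dots> = (\<Sum>j\<leftarrow>[0..<11]. cs ! j * (2 ^ 32 * (int (A j) + int (B j))))"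
  proof -
    have "(\<Sum>c | c \<in> code \<and> 4 dvd hamming_weight c. krawtchouk 66 j (hamming_weight c)) =
        2 ^ 32 * (int (A j) + int (B j))" for j
      using macwilliams[of j] by simp
    then show ?thesis by simp
  qed
  also have "\<dots> = 2 ^ 32 * (\<Sum>j\<leftarrow>[0..<11]. cs ! j * (int (A j) + int (B j)))"
    by (simp only: sum_list_const_mult[symmetric] mult.left_commute)
  finally show ?thesis .
qed

text \<open>Complementation exchanges the two weights. Words of weight 14 are not doubly even, so
  they are reached through their complements.\<close>

lemma A_52_eq_A_14: "A 52 = A 14"
proof (rule bij_betw_same_card[OF bij_betwI[where f = "\<lambda>x. 1 + x" and g = "\<lambda>x. 1 + x"]])
  have *: "hamming_weight (1 + x) = 66 - hamming_weight x" for x :: "bit ^ 66"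
    using hamming_weight_complement[of x] by simp
  show "(+) 1 \<in> {c \<in> code. hamming_weight c = 52} \<rightarrow> {c \<in> code. hamming_weight c = 14}"
    "(+) 1 \<in> {c \<in> code. hamming_weight c = 14} \<rightarrow> {c \<in> code. hamming_weight c = 52}"
    by (auto simp: * one_in_code code_add)
qed (simp_all add: add.assoc[symmetric])

lemma B_10: "B 10 = 0"
proof -
  have "hamming_weight v \<noteq> 10" if "v \<in> shadow" for v
    using odd_weight_shadow[OF that] by (intro notI) simp
  then show ?thesis by (auto simp: card_eq_0_iff)
qed

text \<open>Division of the two interpolated identities by 2 ^ 30 leaves 4 * 286 - 286 = 858 and 4 *
  4686 - 66 = 18678 as constants, while the coefficients at degrees 5 and 9 are multiplied by
  4.\<close>

lemma
  assumes "\<And>w. w \<le> 9 \<Longrightarrow> w \<noteq> 5 \<Longrightarrow> w \<noteq> 9 \<Longrightarrow> B w = 0"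
  shows A_12: "int (A 12) = 858 + 112 * int (B 5) + 8 * int (B 9)"
    and A_14: "int (A 14) = 18678 - 848 * int (B 5) - 24 * int (B 9)"
proof -
  have B: "B 0 = 0" "B 1 = 0" "B 2 = 0" "B 3 = 0" "B 4 = 0" "B 6 = 0" "B 7 = 0" "B 8 = 0"
    using assms[of 0] assms[of 1] assms[of 2] assms[of 3] assms[of 4] assms[of 6] assms[of 7] assms[of 8]
    by simp_all
  have A: "A 1 = 0" "A 2 = 0" "A 3 = 0" "A 4 = 0" "A 5 = 0" "A 6 = 0" "A 7 = 0" "A 8 = 0" "A 9 = 0" "A 10 = 0"
    by (simp_all only: A_light)
  note AB = A A_0 B B_10
  have "(\<Sum>w\<leftarrow>0 # doubly_even_weights. int (A w) * interpolate lagrange_12 w) =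
      307090161664 + int (A 12) * 1073741824"
    using interpolate_12 A_0 unfolding doubly_even_weights_def by simp
  moreover have "(\<Sum>j\<leftarrow>[0..<11]. lagrange_12 ! j * (int (A j) + int (B j))) =
      286 + 28 * int (B 5) + 2 * int (B 9)"
    by (simp only: upt_11 list.map sum_list.Cons sum_list.Nil AB) (simp add: lagrange_12_def)
  ultimately have e12: "307090161664 + int (A 12) * 1073741824 =
      2 ^ 32 * (286 + 28 * int (B 5) + 2 * int (B 9))"
    using interpolate_sum[of lagrange_12] by (simp only:) (simp add: lagrange_12_def)
  have "(\<Sum>w\<leftarrow>0 # doubly_even_weights. int (A w) * interpolate lagrange_52 w) =
      70866960384 + int (A 52) * 1073741824"
    using interpolate_52 A_0 unfolding doubly_even_weights_def by simp
  moreover have "(\<Sum>j\<leftarrow>[0..<11]. lagrange_52 ! j * (int (A j) + int (B j))) =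
      4686 + (- 212) * int (B 5) + (- 6) * int (B 9)"
    by (simp only: upt_11 list.map sum_list.Cons sum_list.Nil AB) (simp add: lagrange_52_def)
  ultimately have e52: "70866960384 + int (A 52) * 1073741824 =
      2 ^ 32 * (4686 + (- 212) * int (B 5) + (- 6) * int (B 9))"
    using interpolate_sum[of lagrange_52] by (simp only:) (simp add: lagrange_52_def)
  show "int (A 12) = 858 + 112 * int (B 5) + 8 * int (B 9)" using e12 by simp
  show "int (A 14) = 18678 - 848 * int (B 5) - 24 * int (B 9)" using e52 A_52_eq_A_14 by simp
qed

end

subsection \<open>Enumeration of light sums\<close>

text \<open>
  The tag of a sum of rows records the indices of these rows.
\<close>

datatype bits = Tag "nat list" | Off bits | On bits

fun tag :: "bits \<Rightarrow> nat list" where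
  "tag (Tag l) = l"
| "tag (Off x) = tag x"
| "tag (On x) = tag x"

fun blen :: "bits \<Rightarrow> nat" where
  "blen (Tag l) = 0"
| "blen (Off x) = Suc (blen x)"
| "blen (On x) = Suc (blen x)"

fun weight :: "bits \<Rightarrow> nat" where
  "weight (Tag l) = 0"
| "weight (Off x) = weight x"
| "weight (On x) = Suc (weight x)"

fun bit_at :: "bits \<Rightarrow> nat \<Rightarrow> bit" where
  "bit_at (Tag l) i = 0"
| "bit_at (Off x) i = (case i of 0 \<Rightarrow> 0 | Suc k \<Rightarrow> bit_at x k)"
| "bit_at (On x) i = (case i of 0 \<Rightarrow> 1 | Suc k \<Rightarrow> bit_at x k)"

text \<open>Concatenating the tags lets a sum remember its summands. The last equation is a default
  for words of different lengths.\<close>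

fun bits_xor :: "bits \<Rightarrow> bits \<Rightarrow> bits" where
  "bits_xor (Tag l) (Tag m) = Tag (l @ m)"
| "bits_xor (Off x) (Off y) = Off (bits_xor x y)"
| "bits_xor (Off x) (On y) = On (bits_xor x y)"
| "bits_xor (On x) (Off y) = On (bits_xor x y)"
| "bits_xor (On x) (On y) = Off (bits_xor x y)"
| "bits_xor x y = Tag []"

lemma blen_bits_xor: "blen x = blen y \<Longrightarrow> blen (bits_xor x y) = blen y"
  by (induction x y rule: bits_xor.induct) auto

lemma tag_bits_xor: "blen x = blen y \<Longrightarrow> tag (bits_xor x y) = tag x @ tag y"
  by (induction x y rule: bits_xor.induct) auto

lemma bit_at_bits_xor: "blen x = blen y \<Longrightarrow> bit_at (bits_xor x y) i = bit_at x i + bit_at y i"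
  by (induction x y arbitrary: i rule: bits_xor.induct) (auto split: nat.split)

lemma sum_of_bool_weight: "weight x = (\<Sum>i<blen x. of_bool (bit_at x i \<noteq> 0))"
  by (induction x) (auto simp: sum.lessThan_Suc_shift simp del: sum.lessThan_Suc)

lemma weight_eq_card: "weight x = card {i. i < blen x \<and> bit_at x i \<noteq> 0}"
proof -
  have "{i. i < blen x \<and> bit_at x i \<noteq> 0} = {..<blen x} \<inter> {i. bit_at x i \<noteq> 0}" by auto
  then show ?thesis by (simp add: sum_of_bool_weight sum_of_bool_eq)
qed

text \<open>
  \<open>Both\<close> is only reached when two words with the same bits meet. It keeps the operations on tries
  lossless without any assumption of linear independence.
\<close>

datatype trie = Empty | Leaf bits | Fork trie trie | Both trie trie

section \<open>Tries: translation, insertion and union\<close>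

fun stored :: "trie \<Rightarrow> bits \<Rightarrow> bool" where
  "stored Empty x = False"
| "stored (Leaf y) x = (x = y)"
| "stored (Fork a b) x = (case x of Tag l \<Rightarrow> False | Off y \<Rightarrow> stored a y | On y \<Rightarrow> stored b y)"
| "stored (Both a b) x = (stored a x \<or> stored b x)"

text \<open>Translation by \<open>r\<close> exchanges the subtrees wherever \<open>r\<close> has a
  one, so nothing has to be inserted again.\<close>

fun trie_shift :: "bits \<Rightarrow> trie \<Rightarrow> trie" where
  "trie_shift r Empty = Empty"
| "trie_shift r (Leaf x) = Leaf (bits_xor r x)"
| "trie_shift (Off r) (Fork a b) = Fork (trie_shift r a) (trie_shift r b)"
| "trie_shift (On r) (Fork a b) = Fork (trie_shift r b) (trie_shift r a)"
| "trie_shift (Tag l) (Fork a b) = Empty"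
| "trie_shift r (Both a b) = Both (trie_shift r a) (trie_shift r b)"

text \<open>A leaf holds a whole remaining suffix; two leaves are separated by forks down to their
  first difference.\<close>

fun fork_leaves :: "bits \<Rightarrow> bits \<Rightarrow> trie" where
  "fork_leaves (Off x) (Off y) = Fork (fork_leaves x y) Empty"
| "fork_leaves (On x) (On y) = Fork Empty (fork_leaves x y)"
| "fork_leaves (Off x) (On y) = Fork (Leaf x) (Leaf y)"
| "fork_leaves (On x) (Off y) = Fork (Leaf y) (Leaf x)"
| "fork_leaves x y = Both (Leaf x) (Leaf y)"

fun trie_insert :: "bits \<Rightarrow> trie \<Rightarrow> trie" where
  "trie_insert x Empty = Leaf x"
| "trie_insert x (Leaf y) = fork_leaves x y"
| "trie_insert (Off x) (Fork c d) = Fork (trie_insert x c) d"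
| "trie_insert (On x) (Fork c d) = Fork c (trie_insert x d)"
| "trie_insert (Tag l) (Fork c d) = Both (Leaf (Tag l)) (Fork c d)"
| "trie_insert x (Both s t) = Both (Leaf x) (Both s t)"

fun trie_merge :: "trie \<Rightarrow> trie \<Rightarrow> trie" where
  "trie_merge Empty t = t"
| "trie_merge (Leaf x) t = trie_insert x t"
| "trie_merge (Fork c d) Empty = Fork c d"
| "trie_merge (Fork c d) (Leaf x) = trie_insert x (Fork c d)"
| "trie_merge (Fork a b) (Fork c d) = Fork (trie_merge a c) (trie_merge b d)"
| "trie_merge (Fork a b) (Both c d) = Both (Fork a b) (Both c d)"
| "trie_merge (Both a b) t = Both (Both a b) t"

lemma stored_trie_shift: "stored t x \<Longrightarrow> blen r = blen x \<Longrightarrow> stored (trie_shift r t) (bits_xor r x)"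
  by (induction r t arbitrary: x rule: trie_shift.induct) (auto split: bits.splits)

lemma stored_fork_leaves: "stored (fork_leaves x y) z \<longleftrightarrow> z = x \<or> z = y"
  by (induction x y arbitrary: z rule: fork_leaves.induct) (auto split: bits.splits)

lemma stored_trie_insert: "stored (trie_insert x t) z \<longleftrightarrow> z = x \<or> stored t z"
  by (induction x t arbitrary: z rule: trie_insert.induct) (auto simp: stored_fork_leaves split: bits.splits)

lemma stored_trie_merge: "stored (trie_merge s t) z \<longleftrightarrow> stored s z \<or> stored t z"
  by (induction s t arbitrary: z rule: trie_merge.induct) (auto simp: stored_trie_insert split: bits.splits)

section \<open>Subset sums graded by the number of summands\<close>

fun add_row_aux :: "bits \<Rightarrow> trie list \<Rightarrow> trie list" where
  "add_row_aux r (s # t # ts) = trie_merge (trie_shift r s) t # add_row_aux r (t # ts)"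
| "add_row_aux r [s] = []"
| "add_row_aux r [] = []"

fun add_row :: "bits \<Rightarrow> trie list \<Rightarrow> trie list" where
  "add_row r (t # ts) = t # add_row_aux r (t # ts)"
| "add_row r [] = []"

text \<open>Entry \<open>k\<close> of the result collects the sums of \<open>k\<close> rows with the
  initial word. Each row moves shifted copies one entry up, and sums of too many rows fall off the
  end.\<close>

fun subset_sums :: "trie list \<Rightarrow> bits list \<Rightarrow> trie list" where
  "subset_sums ts [] = ts"
| "subset_sums ts (r # rs) = add_row r (subset_sums ts rs)"

lemma length_add_row_aux [simp]: "length (add_row_aux r ts) = length ts - 1"
  by (induction r ts rule: add_row_aux.induct) auto

lemma length_add_row [simp]: "length (add_row r ts) = length ts"
  by (cases ts) auto

lemma length_subset_sums [simp]: "length (subset_sums ts rs) = length ts"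
  by (induction rs) auto

lemma nth_add_row_aux:
  "Suc k < length ts \<Longrightarrow> add_row_aux r ts ! k = trie_merge (trie_shift r (ts ! k)) (ts ! Suc k)"
proof (induction r ts arbitrary: k rule: add_row_aux.induct)
  case (1 r s t ts)
  then show ?case by (cases k) auto
qed auto

lemma nth_add_row:
  "k < length ts \<Longrightarrow>
    add_row r ts ! k = (case k of 0 \<Rightarrow> ts ! 0 | Suc i \<Rightarrow> trie_merge (trie_shift r (ts ! i)) (ts ! Suc i))"
  by (cases ts) (auto simp: nth_add_row_aux split: nat.split)

abbreviation sum_of :: "bits list \<Rightarrow> bits \<Rightarrow> bits" where
  "sum_of rs a \<equiv> foldr bits_xor rs a"

lemma blen_sum_of: "\<forall>r\<in>set rs. blen r = blen a \<Longrightarrow> blen (sum_of rs a) = blen a"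
  by (induction rs) (auto simp: blen_bits_xor)

lemma nths_subset: "x \<in> set (nths xs I) \<Longrightarrow> x \<in> set xs"
  by (meson set_nths_subset subsetD)

lemma stored_subset_sums:
  assumes "\<forall>r\<in>set rs. blen r = blen a" "length (nths rs I) < length ts" "stored (ts ! 0) a"
  shows "stored (subset_sums ts rs ! length (nths rs I)) (sum_of (nths rs I) a)"
  using assms
proof (induction rs arbitrary: I)
  case Nil
  then show ?case by simp
next
  case (Cons r rs)
  let ?J = "{j. Suc j \<in> I}"
  have len: "blen (sum_of (nths rs ?J) a) = blen a"
    using Cons.prems by (intro blen_sum_of) (auto dest: nths_subset)
  have IH: "stored (subset_sums ts rs ! length (nths rs ?J)) (sum_of (nths rs ?J) a)"
    using Cons by (intro Cons.IH) (auto simp: nths_Cons)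
  show ?case
  proof (cases "0 \<in> I")
    case True
    then show ?thesis
      using Cons.prems IH len
      by (auto simp: nths_Cons nth_add_row stored_trie_merge intro!: stored_trie_shift)
  next
    case False
    then show ?thesis
      using Cons.prems IH
      by (auto simp: nths_Cons nth_add_row stored_trie_merge split: nat.split)
  qed
qed

section \<open>Simultaneous descent with a bounded number of disagreements\<close>

fun match_leaf :: "bits \<Rightarrow> bits \<Rightarrow> nat \<Rightarrow> nat list list \<Rightarrow> nat list list" where
  "match_leaf (Tag l) (Tag m) b acc = (l @ m) # acc"
| "match_leaf (Off x) (Off y) b acc = match_leaf x y b acc"
| "match_leaf (On x) (On y) b acc = match_leaf x y b acc"
| "match_leaf (Off x) (On y) 0 acc = acc"
| "match_leaf (On x) (Off y) 0 acc = acc"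
| "match_leaf (Off x) (On y) (Suc b) acc = match_leaf x y b acc"
| "match_leaf (On x) (Off y) (Suc b) acc = match_leaf x y b acc"
| "match_leaf x y b acc = acc"

fun match_trie :: "bits \<Rightarrow> trie \<Rightarrow> nat \<Rightarrow> nat list list \<Rightarrow> nat list list" where
  "match_trie x Empty b acc = acc"
| "match_trie x (Leaf y) b acc = match_leaf x y b acc"
| "match_trie (Off x) (Fork c d) 0 acc = match_trie x c 0 acc"
| "match_trie (On x) (Fork c d) 0 acc = match_trie x d 0 acc"
| "match_trie (Off x) (Fork c d) (Suc b) acc = match_trie x c (Suc b) (match_trie x d b acc)"
| "match_trie (On x) (Fork c d) (Suc b) acc = match_trie x d (Suc b) (match_trie x c b acc)"
| "match_trie (Tag l) (Fork c d) b acc = acc"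
| "match_trie x (Both c d) b acc = match_trie x c b (match_trie x d b acc)"


text \<open>Descending into equal sides keeps the budget \<open>b\<close>, descending into opposite
  sides costs one unit, so pairs of subtrees are abandoned as soon as their prefixes differ too
  often.\<close>

fun match_tries :: "trie \<Rightarrow> trie \<Rightarrow> nat \<Rightarrow> nat list list \<Rightarrow> nat list list" where
  "match_tries Empty t b acc = acc"
| "match_tries (Leaf x) t b acc = match_trie x t b acc"
| "match_tries (Fork c d) Empty b acc = acc"
| "match_tries (Fork c d) (Leaf (Off y)) 0 acc = match_tries c (Leaf y) 0 acc"
| "match_tries (Fork c d) (Leaf (On y)) 0 acc = match_tries d (Leaf y) 0 acc"
| "match_tries (Fork c d) (Leaf (Off y)) (Suc b) acc = match_tries c (Leaf y) (Suc b) (match_tries d (Leaf y) b acc)"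
| "match_tries (Fork c d) (Leaf (On y)) (Suc b) acc = match_tries d (Leaf y) (Suc b) (match_tries c (Leaf y) b acc)"
| "match_tries (Fork c d) (Leaf (Tag l)) b acc = acc"
| "match_tries (Fork c d) (Fork e f) 0 acc = match_tries c e 0 (match_tries d f 0 acc)"
| "match_tries (Fork c d) (Fork e f) (Suc b) acc =
     match_tries c e (Suc b) (match_tries d f (Suc b) (match_tries c f b (match_tries d e b acc)))"
| "match_tries (Fork c d) (Both e f) b acc = match_tries (Fork c d) e b (match_tries (Fork c d) f b acc)"
| "match_tries (Both c d) t b acc = match_tries c t b (match_tries d t b acc)"

text \<open>Nested calls pass their results through \<open>acc\<close>; the completeness proofs need
  that a match found by an inner call survives the outer ones.\<close>

lemma match_leaf_acc: "set acc \<subseteq> set (match_leaf x y b acc)"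
  by (induction x y b acc rule: match_leaf.induct) auto

lemma match_trie_acc: "set acc \<subseteq> set (match_trie x t b acc)"
proof (induction x t b acc rule: match_trie.induct)
  case (2 x y b acc)
  then show ?case by (simp add: match_leaf_acc)
qed auto

lemma match_tries_acc: "set acc \<subseteq> set (match_tries s t b acc)"
proof (induction s t b acc rule: match_tries.induct)
  case (2 x t b acc)
  then show ?case by (simp add: match_trie_acc)
qed auto

lemma match_leaf_complete:
  "blen x = blen y \<Longrightarrow> weight (bits_xor x y) \<le> b \<Longrightarrow> tag x @ tag y \<in> set (match_leaf x y b acc)"
  by (induction x y b acc rule: match_leaf.induct) auto

lemma match_trie_complete:
  "blen x = blen y \<Longrightarrow> stored t y \<Longrightarrow> weight (bits_xor x y) \<le> b \<Longrightarrow>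
    tag x @ tag y \<in> set (match_trie x t b acc)"
proof (induction x t b acc arbitrary: y rule: match_trie.induct)
  case (2 x y b acc)
  then show ?case by (simp add: match_leaf_complete)
next
  case (5 x c d b acc)
  then show ?case using match_trie_acc by (cases y) fastforce+
next
  case (6 x c d b acc)
  then show ?case using match_trie_acc by (cases y) fastforce+
next
  case (8 x c d b acc)
  then show ?case using match_trie_acc[of "match_trie x d b acc" x c b] by auto
qed (auto split: bits.splits)

lemma match_tries_complete:
  "blen x = blen y \<Longrightarrow> stored s x \<Longrightarrow> stored t y \<Longrightarrow> weight (bits_xor x y) \<le> b \<Longrightarrow>
    tag x @ tag y \<in> set (match_tries s t b acc)"
proof (induction s t b acc arbitrary: x y rule: match_tries.induct)
  case (2 x t b acc)
  then show ?case by (simp add: match_trie_complete)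
next
  case (6 c d z b acc)
  then show ?case using match_tries_acc by (cases x) fastforce+
next
  case (7 c d z b acc)
  then show ?case using match_tries_acc by (cases x) fastforce+
next
  case (9 c d e f acc)
  then show ?case using match_tries_acc by (cases x; cases y) fastforce+
next
  case (10 c d e f b acc)
  \<comment> \<open>Peels off the outer calls once a match is known to be in their
    accumulator.\<close>
  note acc = subsetD [OF match_tries_acc]
  show ?case
  proof (cases x)
    case (Off u)
    note x = this
    show ?thesis
    proof (cases y)
      case (Off v)
      then show ?thesis using "10.IH"(4)[of u v] "10.prems" x by simp
    next
      case (On v)
      then have "tag u @ tag v \<in> set (match_tries c f b (match_tries d e b acc))"
        using "10.IH"(2)[of u v] "10.prems" x by simp
      then show ?thesis unfolding x On match_tries.simps tag.simps by - (assumption | rule acc)+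
    qed (use "10.prems" in auto)
  next
    case (On u)
    note x = this
    show ?thesis
    proof (cases y)
      case (Off v)
      then have "tag u @ tag v \<in> set (match_tries d e b acc)"
        using "10.IH"(1)[of u v] "10.prems" x by simp
      then show ?thesis unfolding x Off match_tries.simps tag.simps by - (assumption | rule acc)+
    next
      case (On v)
      then have "tag u @ tag v \<in> set (match_tries d f (Suc b) (match_tries c f b (match_tries d e b acc)))"
        using "10.IH"(3)[of u v] "10.prems" x by simp
      then show ?thesis unfolding x On match_tries.simps tag.simps by - (assumption | rule acc)+
    qed (use "10.prems" in auto)
  qed (use "10.prems" in auto)
next
  case (11 c d e f b acc)
  then consider "stored e y" | "stored f y" by auto
  then show ?case
  proof cases
    case 1
    then show ?thesis using "11.IH"(2) "11.prems" by simp
  next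
    case 2
    then have "tag x @ tag y \<in> set (match_tries (Fork c d) f b acc)"
      using "11.IH"(1) "11.prems" by simp
    then show ?thesis unfolding match_tries.simps by (rule subsetD[OF match_tries_acc])
  qed
next
  case (12 c d t b acc)
  then consider "stored c x" | "stored d x" by auto
  then show ?case
  proof cases
    case 1
    then show ?thesis using "12.IH"(2) "12.prems" by simp
  next
    case 2
    then have "tag x @ tag y \<in> set (match_tries d t b acc)"
      using "12.IH"(1) "12.prems" by simp
    then show ?thesis unfolding match_tries.simps by (rule subsetD[OF match_tries_acc])
  qed
qed (auto split: bits.splits)

text \<open>The budget covers rows and disagreements together: each step along the list stands for
  one more row and costs one unit.\<close>

fun match_row :: "trie \<Rightarrow> trie list \<Rightarrow> nat \<Rightarrow> nat list list \<Rightarrow> nat list list" where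
  "match_row a [] b acc = acc"
| "match_row a (t # ts) 0 acc = match_tries a t 0 acc"
| "match_row a (t # ts) (Suc b) acc = match_tries a t (Suc b) (match_row a ts b acc)"

text \<open>With every row taken from the first part, \<open>butlast\<close> forbids one row of the
  second, which bounds the total number of rows.\<close>

fun match_all :: "trie list \<Rightarrow> trie list \<Rightarrow> nat \<Rightarrow> nat list list \<Rightarrow> nat list list" where
  "match_all [] ts b acc = acc"
| "match_all (s # ss) ts 0 acc = match_row s ts 0 acc"
| "match_all (s # ss) ts (Suc b) acc = match_row s ts (Suc b) (match_all ss (butlast ts) b acc)"

lemma match_row_acc: "set acc \<subseteq> set (match_row s ts b acc)"
proof (induction s ts b acc rule: match_row.induct)
  case (2 a t ts acc)
  then show ?case by (simp add: match_tries_acc)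
next
  case (3 a t ts b acc)
  then show ?case using match_tries_acc[of "match_row a ts b acc" a t "Suc b"] by auto
qed auto

lemma match_row_complete:
  "blen x = blen y \<Longrightarrow> j < length ts \<Longrightarrow> stored s x \<Longrightarrow> stored (ts ! j) y \<Longrightarrow>
    j + weight (bits_xor x y) \<le> b \<Longrightarrow> tag x @ tag y \<in> set (match_row s ts b acc)"
proof (induction s ts b acc arbitrary: j rule: match_row.induct)
  case (2 a t ts acc)
  then show ?case by (simp add: match_tries_complete)
next
  case (3 a t ts b acc)
  show ?case
  proof (cases j)
    case 0
    then show ?thesis using 3 by (simp add: match_tries_complete)
  next
    case (Suc i)
    then have "tag x @ tag y \<in> set (match_row a ts b acc)" using 3 by simp
    then show ?thesis using match_tries_acc[of "match_row a ts b acc" a t "Suc b"] by auto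
  qed
qed auto

lemma match_all_complete:
  "blen x = blen y \<Longrightarrow> i < length ss \<Longrightarrow> i + j < length ts \<Longrightarrow> stored (ss ! i) x \<Longrightarrow>
    stored (ts ! j) y \<Longrightarrow> i + j + weight (bits_xor x y) \<le> b \<Longrightarrow>
    tag x @ tag y \<in> set (match_all ss ts b acc)"
proof (induction ss ts b acc arbitrary: i rule: match_all.induct)
  case (2 s ss ts acc)
  then show ?case using match_row_complete[of x y j ts s 0 acc] by auto
next
  case (3 s ss ts b acc)
  show ?case
  proof (cases i)
    case 0
    then show ?thesis using 3 by (auto intro!: match_row_complete[where j = j])
  next
    case (Suc k)
    then have "tag x @ tag y \<in> set (match_all ss (butlast ts) b acc)"
      using 3 by (intro 3(1)[of k]) (auto simp: nth_butlast)
    then show ?thesis using subsetD[OF match_row_acc] by simp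
  qed
qed auto

text \<open>At most \<open>k\<close> rows are used, and \<open>b\<close> bounds their number plus
  the weight of their sum with \<open>a\<close> and \<open>z\<close>. The word \<open>a\<close>
  carries the shift to the shadow.\<close>

definition light_sums :: "nat \<Rightarrow> nat \<Rightarrow> bits list \<Rightarrow> bits list \<Rightarrow> bits \<Rightarrow> bits \<Rightarrow> nat list list" where
  "light_sums k b rs rs' a z =
    match_all (subset_sums (Leaf a # replicate k Empty) rs) (subset_sums (Leaf z # replicate k Empty) rs') b []"

lemma bits_xor_sum_of:
  assumes "\<forall>r\<in>set rs \<union> set rs'. blen r = m" "blen a = m" "blen z = m"
  shows "bit_at (bits_xor (sum_of rs a) (sum_of rs' z)) j = bit_at a j + bit_at z j + (\<Sum>r\<leftarrow>rs @ rs'. bit_at r j)"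
proof -
  have 1: "bit_at (sum_of rs a) j = bit_at a j + (\<Sum>r\<leftarrow>rs. bit_at r j)" if "\<forall>r\<in>set rs. blen r = blen a" for rs a
    using that by (induction rs) (auto simp: bit_at_bits_xor blen_sum_of algebra_simps)
  show ?thesis using assms
    by (simp add: bit_at_bits_xor blen_sum_of 1 algebra_simps)
qed

lemma tag_sum_of: "\<forall>r\<in>set rs. blen r = blen a \<Longrightarrow> tag (sum_of rs a) = concat (map tag rs) @ tag a"
  by (induction rs) (auto simp: tag_bits_xor blen_sum_of)

text \<open>\<open>I\<close> is cut at \<open>length rs\<close>. The two partial sums disagree
  exactly where the full sum is nonzero, so a light sum is a close pair.\<close>

lemma light_sums_complete:
  assumes len: "\<forall>r\<in>set (rs @ rs'). blen r = m" "blen a = m" "blen z = m"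
    and tags: "tag a = []" "tag z = []"
    and "length (nths (rs @ rs') I) \<le> k"
    and "length (nths (rs @ rs') I) + card {j. j < m \<and> bit_at a j + bit_at z j + (\<Sum>r\<leftarrow>nths (rs @ rs') I. bit_at r j) \<noteq> 0} \<le> b"
  shows "concat (map tag (nths (rs @ rs') I)) \<in> set (light_sums k b rs rs' a z)"
proof -
  define J where "J = {j. j + length rs \<in> I}"
  define x where "x = sum_of (nths rs I) a"
  define y where "y = sum_of (nths rs' J) z"
  have app: "nths (rs @ rs') I = nths rs I @ nths rs' J"
    by (simp add: nths_append J_def)
  have bl: "\<forall>r\<in>set (nths rs I) \<union> set (nths rs' J). blen r = m"
    using len by (auto dest: nths_subset)
  have blx: "blen x = m" "blen y = m"
    using bl len by (auto simp: x_def y_def blen_sum_of)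
  have w: "weight (bits_xor x y) = card {j. j < m \<and> bit_at a j + bit_at z j + (\<Sum>r\<leftarrow>nths (rs @ rs') I. bit_at r j) \<noteq> 0}"
  proof -
    have "bit_at (bits_xor x y) j = bit_at a j + bit_at z j + (\<Sum>r\<leftarrow>nths (rs @ rs') I. bit_at r j)" for j
      unfolding x_def y_def app using bl len by (intro bits_xor_sum_of) auto
    then show ?thesis using blx by (simp add: weight_eq_card blen_bits_xor)
  qed
  have "tag x @ tag y \<in> set (light_sums k b rs rs' a z)"
    unfolding light_sums_def
  proof (rule match_all_complete)
    show "stored (subset_sums (Leaf a # replicate k Empty) rs ! length (nths rs I)) x"
      unfolding x_def using len assms(6) app by (intro stored_subset_sums) auto
    show "stored (subset_sums (Leaf z # replicate k Empty) rs' ! length (nths rs' J)) y"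
      unfolding y_def using len assms(6) app by (intro stored_subset_sums) auto
  qed (use blx assms w app in auto)
  moreover have "tag x @ tag y = concat (map tag (nths (rs @ rs') I))"
    using bl len tags by (simp add: x_def y_def tag_sum_of app)
  ultimately show ?thesis by simp
qed

section \<open>Matrices as lists of bit vectors: transposition, orthogonality, selection of
  rows\<close>

fun to_bits :: "nat list \<Rightarrow> nat \<Rightarrow> nat list \<Rightarrow> bits" where
  "to_bits [] n l = Tag l"
| "to_bits (i # is) n l = (if even n then Off else On) (to_bits is (n div 2) l)"

lemma tag_to_bits [simp]: "tag (to_bits is n l) = l"
  by (induction "is" arbitrary: n) auto

lemma blen_to_bits [simp]: "blen (to_bits is n l) = length is"
  by (induction "is" arbitrary: n) auto

fun column :: "nat list \<Rightarrow> bits list \<Rightarrow> bits" where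
  "column l [] = Tag l"
| "column l (Off x # R) = Off (column l R)"
| "column l (On x # R) = On (column l R)"
| "column l (Tag m # R) = Off (column l R)"

fun tail :: "bits \<Rightarrow> bits" where
  "tail (Off x) = x"
| "tail (On x) = x"
| "tail (Tag l) = Tag l"

text \<open>Transposition, one coordinate of all rows at a time; \<open>is\<close> supplies the tags
  of the columns.\<close>

fun columns :: "nat list \<Rightarrow> bits list \<Rightarrow> bits list" where
  "columns [] R = []"
| "columns (i # is) R = column [i] R # columns is (map tail R)"

lemma blen_column [simp]: "blen (column l R) = length R"
  by (induction l R rule: column.induct) auto

lemma tag_column [simp]: "tag (column l R) = l"
  by (induction l R rule: column.induct) auto

lemma bit_at_column: "i < length R \<Longrightarrow> bit_at (column l R) i = bit_at (R ! i) 0"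
  by (induction l R arbitrary: i rule: column.induct) (auto simp: nth_Cons split: nat.split)

lemma bit_at_tail: "bit_at (tail x) i = bit_at x (Suc i)"
  by (cases x) auto

lemma length_columns [simp]: "length (columns is R) = length is"
  by (induction "is" arbitrary: R) auto

lemma bit_at_columns:
  "j < length is \<Longrightarrow> i < length R \<Longrightarrow> bit_at (columns is R ! j) i = bit_at (R ! i) j"
  by (induction "is" arbitrary: R j) (auto simp: nth_Cons bit_at_column bit_at_tail split: nat.split)

lemma map_tag_columns: "map tag (columns is R) = map (\<lambda>i. [i]) is"
  by (induction "is" arbitrary: R) auto

lemma blen_columns: "r \<in> set (columns is R) \<Longrightarrow> blen r = length R"
  by (induction "is" arbitrary: R) auto

fun odd_overlap :: "bits \<Rightarrow> bits \<Rightarrow> bool" where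
  "odd_overlap (On x) (On y) = (\<not> odd_overlap x y)"
| "odd_overlap (On x) (Off y) = odd_overlap x y"
| "odd_overlap (Off x) (On y) = odd_overlap x y"
| "odd_overlap (Off x) (Off y) = odd_overlap x y"
| "odd_overlap x y = False"

lemma odd_overlap:
  "blen x = blen y \<Longrightarrow> (\<Sum>j<blen y. bit_at x j * bit_at y j) = of_bool (odd_overlap x y)"
  by (induction x y rule: odd_overlap.induct)
    (auto simp: sum.lessThan_Suc_shift simp del: sum.lessThan_Suc)

fun orthonormal :: "bits list \<Rightarrow> bool" where
  "orthonormal [] = True"
| "orthonormal (r # rs) = (odd_overlap r r \<and> list_all (\<lambda>s. \<not> odd_overlap r s) rs \<and> orthonormal rs)"

text \<open>The test visits each unordered pair of rows once; the other order follows by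
  commutativity.\<close>

lemma orthonormal_nth:
  assumes "orthonormal R" "\<forall>r\<in>set R. blen r = n" "i < length R" "k < length R"
  shows "(\<Sum>j<n. bit_at (R ! i) j * bit_at (R ! k) j) = of_bool (i = k)"
  using assms
proof (induction R arbitrary: i k)
  case (Cons r R)
  have *: "(\<Sum>j<n. bit_at x j * bit_at y j) = of_bool (odd_overlap x y)"
    if "x \<in> set (r # R)" "y \<in> set (r # R)" for x y
  proof -
    have "blen x = n" "blen y = n" using that Cons.prems(2) by auto
    then show ?thesis using odd_overlap[of x y] by simp
  qed
  have **: "\<not> odd_overlap r s" "\<not> odd_overlap s r" if "s \<in> set R" for s
  proof -
    show "\<not> odd_overlap r s" using Cons.prems(1) that by (simp add: list_all_iff)
    with *[of r s] *[of s r] that show "\<not> odd_overlap s r"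
      by (simp add: mult.commute)
  qed
  show ?case
  proof (cases i; cases k)
    fix i' k' assume "i = Suc i'" "k = Suc k'"
    then show ?thesis using Cons by simp
  qed (use Cons.prems ** * in auto)
qed simp

text \<open>Recursion on successors fits the unary numbers produced by
  \<open>weight\<close>.\<close>

fun divisible_by_4 :: "nat \<Rightarrow> bool" where
  "divisible_by_4 0 = True"
| "divisible_by_4 (Suc 0) = False"
| "divisible_by_4 (Suc (Suc 0)) = False"
| "divisible_by_4 (Suc (Suc (Suc 0))) = False"
| "divisible_by_4 (Suc (Suc (Suc (Suc n)))) = divisible_by_4 n"

lemma divisible_by_4: "divisible_by_4 n \<longleftrightarrow> 4 dvd n"
proof (induction n rule: divisible_by_4.induct)
  case (5 n)
  have "Suc (Suc (Suc (Suc n))) = n + 4" by simp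
  with 5 show ?case by (metis divisible_by_4.simps(5) dvd_add_triv_right_iff)
qed (auto, presburger+)

fun overlaps :: "bits \<Rightarrow> bits list \<Rightarrow> bits" where
  "overlaps t [] = Tag []"
| "overlaps t (r # R) = (if odd_overlap t r then On else Off) (overlaps t R)"

lemma blen_overlaps [simp]: "blen (overlaps t R) = length R"
  by (induction R) auto

lemma tag_overlaps [simp]: "tag (overlaps t R) = []"
  by (induction R) auto

lemma bit_at_overlaps: "i < length R \<Longrightarrow> bit_at (overlaps t R) i = of_bool (odd_overlap t (R ! i))"
  by (induction R arbitrary: i) (auto simp: nth_Cons split: nat.split)

text \<open>The word pA + a, that is, the right half belonging to the left half
  \<open>p\<close>.\<close>

fun select_sum :: "bits \<Rightarrow> bits list \<Rightarrow> bits \<Rightarrow> bits" where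
  "select_sum (On p) (r # R) a = bits_xor r (select_sum p R a)"
| "select_sum (Off p) (r # R) a = select_sum p R a"
| "select_sum p R a = a"

text \<open>Writes a support in the form of a tag, for comparison with the output of the
  enumeration.\<close>

fun positions :: "bits \<Rightarrow> nat list \<Rightarrow> nat list" where
  "positions (On p) (i # is) = i # positions p is"
| "positions (Off p) (i # is) = positions p is"
| "positions p is = []"

lemma blen_select_sum:
  "\<forall>r\<in>set R. blen r = blen a \<Longrightarrow> blen (select_sum p R a) = blen a"
  by (induction p R a rule: select_sum.induct) (auto simp: blen_bits_xor)

lemma bit_at_select_sum:
  "\<forall>r\<in>set R. blen r = blen a \<Longrightarrow> blen p = length R \<Longrightarrow>
    bit_at (select_sum p R a) j = bit_at a j + (\<Sum>i<length R. bit_at p i * bit_at (R ! i) j)"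
  by (induction p R a rule: select_sum.induct)
    (auto simp: bit_at_bits_xor blen_select_sum sum.lessThan_Suc_shift ac_simps simp del: sum.lessThan_Suc)

lemma positions_eq: "blen p = length is \<Longrightarrow> positions p is = nths is {i. bit_at p i \<noteq> 0}"
  by (induction p "is" rule: positions.induct) (auto simp: nths_Cons)

lemma bits_eqI:
  "blen x = blen y \<Longrightarrow> tag x = tag y \<Longrightarrow> (\<And>i. i < blen x \<Longrightarrow> bit_at x i = bit_at y i) \<Longrightarrow> x = y"
proof (induction x arbitrary: y)
  case (Tag l)
  then show ?case by (cases y) auto
next
  case (Off x)
  show ?case using Off.prems Off.prems(3)[of 0] Off.prems(3)[of "Suc _"] Off.IH by (cases y) auto
next
  case (On x)
  show ?case using On.prems On.prems(3)[of 0] On.prems(3)[of "Suc _"] On.IH by (cases y) auto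
qed

lemma sum_list_nths:
  "(\<Sum>x\<leftarrow>nths xs I. f x) = (\<Sum>i | i < length xs \<and> i \<in> I. f (xs ! i))"
  for f :: "'a \<Rightarrow> 'b :: comm_monoid_add"
proof (induction xs rule: rev_induct)
  case (snoc x xs)
  have "{i. i < length (xs @ [x]) \<and> i \<in> I} =
      (if length xs \<in> I then insert (length xs) else id) {i. i < length xs \<and> i \<in> I}"
    by (auto simp: less_Suc_eq)
  then show ?case
    using snoc by (auto simp: nths_append nths_singleton nth_append add.commute intro!: sum.cong)
qed simp

lemma nths_upt_inj:
  assumes "nths [0..<n] I = nths [0..<n] J" "i < n"
  shows "i \<in> I \<longleftrightarrow> i \<in> J"
proof -
  have "set (nths [0..<n] K) = {i. i < n \<and> i \<in> K}" for K
    by (auto simp: set_nths) (metis add_0 nth_upt)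
  then show ?thesis using assms by (metis (mono_tags, lifting) mem_Collect_eq)
qed

text \<open>As row \<open>i\<close> has the tag \<open>[i]\<close>, a match is reported as the
  increasing list of \<open>I\<close>. The term \<open>card I\<close> is the weight of the other
  half of the word.\<close>

lemma light_sums_rows:
  assumes "\<forall>r\<in>set R. blen r = m" "map tag R = map (\<lambda>i. [i]) [0..<n]" "blen a = m" "tag a = []"
    and "I \<subseteq> {..<n}" "card I \<le> k"
    and "card I + card {j. j < m \<and> bit_at a j + (\<Sum>i\<in>I. bit_at (R ! i) j) \<noteq> 0} \<le> b"
  shows "nths [0..<n] I \<in> set (light_sums k b (take h R) (drop h R) a (to_bits [0..<m] 0 []))"
proof -
  have len: "length R = n" using assms(2) by (metis length_map length_upt minus_nat.diff_0)
  have I: "{i. i < length R \<and> i \<in> I} = I" using assms(5) len by auto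
  have z: "bit_at (to_bits is 0 []) j = 0" for j "is"
    by (induction "is" arbitrary: j) (auto split: nat.split)
  have "concat (map tag (nths (take h R @ drop h R) I)) \<in>
      set (light_sums k b (take h R) (drop h R) a (to_bits [0..<m] 0 []))"
    using assms len by (intro light_sums_complete[where m = m])
      (auto simp: length_nths I sum_list_nths z simp del: bit_not_zero_iff)
  moreover have "concat (map tag (nths R I)) = concat (nths (map tag R) I)"
    by (simp add: nths_map)
  moreover have "\<dots> = concat (map (\<lambda>i. [i]) (nths [0..<n] I))"
    by (simp add: assms(2) nths_map)
  moreover have "\<dots> = nths [0..<n] I" by (simp add: concat_map_singleton)
  ultimately show ?thesis by simp
qed

subsection \<open>Certificates\<close>

lemma coeff_weight_enumerator:
  "i \<le> CARD('n) \<Longrightarrow> coeff (weight_enumerator C) i = card {c \<in> C. hamming_weight c = i}" for C :: "(bit ^ 'n) set"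
  by (simp add: weight_enumerator_def coeff_sum sum.delta)

lemma min_distance_eqI:
  fixes C :: "(bit ^ 'n) set"
  assumes "\<And>x y. x \<in> C \<Longrightarrow> y \<in> C \<Longrightarrow> x + y \<in> C"
    and "\<And>x. x \<in> C \<Longrightarrow> x \<noteq> 0 \<Longrightarrow> d \<le> hamming_weight x"
    and "0 \<in> C" "x \<in> C" "x \<noteq> 0" "hamming_weight x = d"
  shows "min_distance C = d"
  unfolding min_distance_def
proof (rule Min_eqI)
  show "finite {hamming_distance x y |x y. x \<in> C \<and> y \<in> C \<and> x \<noteq> y}"
    by (rule finite_subset[of _ "{..CARD('n)}"]) (auto simp: hamming_distance_eq hamming_weight_le)
  show "d \<le> k" if "k \<in> {hamming_distance x y |x y. x \<in> C \<and> y \<in> C \<and> x \<noteq> y}" for k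
  proof -
    obtain x y where "k = hamming_weight (x + y)" "x \<in> C" "y \<in> C" "x \<noteq> y"
      using \<open>k \<in> _\<close> by (auto simp: hamming_distance_eq)
    moreover from this have "x + y \<noteq> 0" by (metis add.assoc add_0 add_0_right word_add_self)
    ultimately show ?thesis using assms by simp
  qed
  show "d \<in> {hamming_distance x y |x y. x \<in> C \<and> y \<in> C \<and> x \<noteq> y}"
    using assms by (force simp: hamming_distance_eq)
qed

text \<open>The weight of the shadow word (p, pA + t).\<close>

definition shadow_weight :: "bits list \<Rightarrow> bits \<Rightarrow> bits \<Rightarrow> nat" where
  "shadow_weight R t p = weight p + weight (select_sum p R t)"

text \<open>
  \<open>R\<close> lists the rows of \<open>A\<close>. The shadow is the coset of \<open>(0, t)\<close>, or equivalently of
  \<open>(overlaps t R, 0)\<close>, and \<open>P\<close> lists the left halves of its words of weight at most 9: \<open>b5\<close> words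
  of weight 5 followed by \<open>b9\<close> words of weight 9. A word of weight at most 10 has at most 5 ones
  on the left or at most 4 on the right, and a word of weight at most 9 has at most 4 on one side,
  hence the bounds in the four enumerations.
\<close>

locale code_certificate =
  fixes R :: "bits list" and t :: bits and P :: "bits list" and b5 b9 :: nat
  assumes blen_R: "\<forall>r\<in>set R. blen r = 33" and tag_R: "map tag R = map (\<lambda>i. [i]) [0..<33]"
    and t: "blen t = 33" "tag t = []"
    and P: "\<forall>p\<in>set P. blen p = 33 \<and> tag p = []" "distinct P"
    and orthonormal_rows: "orthonormal R"
    and orthonormal_columns: "orthonormal (columns [0..<33] R)"
    and shadow_rows: "list_all (\<lambda>r. odd_overlap t r \<noteq> divisible_by_4 (Suc (weight r))) R"
    and shadow_weights: "map (shadow_weight R t) P = replicate b5 5 @ replicate b9 9"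
    and code_rows:
      "light_sums 5 10 (take 16 R) (drop 16 R) (to_bits [0..<33] 0 []) (to_bits [0..<33] 0 []) = [[]]"
    and code_columns:
      "light_sums 4 10 (take 16 (columns [0..<33] R)) (drop 16 (columns [0..<33] R))
        (to_bits [0..<33] 0 []) (to_bits [0..<33] 0 []) = [[]]"
    and shadow_light_rows:
      "list_all (\<lambda>l. l \<in> set (map (\<lambda>p. positions p [0..<33]) P))
        (light_sums 4 9 (take 16 R) (drop 16 R) t (to_bits [0..<33] 0 []))"
    and shadow_light_columns:
      "list_all (\<lambda>l. l \<in> set (map (\<lambda>p. positions (select_sum p R t) [0..<33]) P))
        (light_sums 4 9 (take 16 (columns [0..<33] R)) (drop 16 (columns [0..<33] R))
          (overlaps t R) (to_bits [0..<33] 0 []))"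
begin

lemma length_R: "length R = 33"
  using tag_R by (metis length_map length_upt minus_nat.diff_0)

abbreviation Q :: "bits list" where
  "Q \<equiv> columns [0..<33] R"

lemma blen_Q: "\<forall>q\<in>set Q. blen q = 33"
  using length_R by (auto dest: blen_columns)

lemma bit_at_Q: "i < 33 \<Longrightarrow> j < 33 \<Longrightarrow> bit_at (Q ! j) i = bit_at (R ! i) j"
  by (simp add: bit_at_columns length_R)

lemma bit_at_zero [simp]: "bit_at (to_bits is 0 l) j = 0"
  by (induction "is" arbitrary: j) (auto split: nat.split)

lemma blen_nth: "i < 33 \<Longrightarrow> blen (R ! i) = 33"
  using blen_R length_R by simp

lemma overlap_t: "i < 33 \<Longrightarrow> (\<Sum>j<33. bit_at t j * bit_at (R ! i) j) = of_bool (odd_overlap t (R ! i))"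
  using odd_overlap[of t "R ! i"] by (simp add: blen_nth t)

lemma sum_mult_support:
  "(\<Sum>i<33. x i * f i) = (\<Sum>i | i < 33 \<and> x i \<noteq> 0. f i)" for x f :: "nat \<Rightarrow> bit"
  using sum_if_bit[of "{..<33}" x f] by simp

lemma systematic:
  assumes "bij_betw h {..<66} (UNIV :: 66 set)"
  shows "systematic_code h (\<lambda>j. h (33 + j)) 33 (\<lambda>i. bit_at (R ! i))"
proof
  have inj: "inj_on h {..<66}" and surj: "h ` {..<66} = UNIV"
    using assms by (auto simp: bij_betw_def)
  have r: "(\<lambda>j. h (33 + j)) ` {..<33} = h ` {33..<66}"
  proof -
    have "{33..<66 :: nat} = (+) 33 ` {..<33}"
      by (simp add: lessThan_atLeast0)
    then show ?thesis by (simp add: image_image)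
  qed
  have split: "{..<66 :: nat} = {..<33} \<union> {33..<66}" by auto
  show "inj_on h {..<33}" using inj by (rule inj_on_subset) auto
  show "inj_on (\<lambda>j. h (33 + j)) {..<33}"
  proof (rule inj_onI)
    fix x y :: nat assume "x \<in> {..<33}" "y \<in> {..<33}" "h (33 + x) = h (33 + y)"
    then have "33 + x = 33 + y" by (intro inj_onD[OF inj]) auto
    then show "x = y" by simp
  qed
  show "h ` {..<33} \<inter> (\<lambda>j. h (33 + j)) ` {..<33} = {}"
    unfolding r using inj by (subst inj_on_image_Int[symmetric, of h "{..<66}"]) auto
  show "h ` {..<33} \<union> (\<lambda>j. h (33 + j)) ` {..<33} = UNIV"
    unfolding r image_Un[symmetric] split[symmetric] by (rule surj)
  show "(\<Sum>j<33. bit_at (R ! i) j * bit_at (R ! i') j) = of_bool (i = i')" if "i < 33" "i' < 33" for i i'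
    using that orthonormal_nth[OF orthonormal_rows blen_R] length_R by simp
  show "(\<Sum>i<33. bit_at (R ! i) j * bit_at (R ! i) j') = of_bool (j = j')" if "j < 33" "j' < 33" for j j'
    using that orthonormal_nth[OF orthonormal_columns blen_Q, of j j'] by (simp add: bit_at_Q)
qed

lemma length_filter_shadow_weight:
  "length (filter (\<lambda>p. shadow_weight R t p = w) P) = (if w = 5 then b5 else if w = 9 then b9 else 0)"
proof -
  have "length (filter (\<lambda>p. shadow_weight R t p = w) P) = length (filter (\<lambda>k. k = w) (map (shadow_weight R t) P))"
    by (simp add: filter_map comp_def)
  then show ?thesis by (simp add: shadow_weights)
qed

text \<open>The enumerations over rows and columns first exclude light codewords and then show that
  \<open>P\<close> is the complete list of light shadow words. The MacWilliams identities give the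
  two coefficients, and the first of them also yields a word of weight 12.\<close>

lemma code_exists:
  shows "\<exists>C :: (bit ^ 66) set. binary_code 33 12 C \<and> extremal_self_dual C \<and>
    int (coeff (weight_enumerator C) 12) = 858 + 112 * int b5 + 8 * int b9 \<and>
    int (coeff (weight_enumerator C) 14) = 18678 - 848 * int b5 - 24 * int b9"
proof -
  obtain h :: "nat \<Rightarrow> 66" where "bij_betw h {0..<66} UNIV"
    using ex_bij_betw_nat_finite[of "UNIV :: 66 set"] by auto
  then have h: "bij_betw h {..<66} (UNIV :: 66 set)"
    by (simp add: lessThan_atLeast0)
  define l where "l = h"
  define r where "r j = h (33 + j)" for j
  let ?a = "\<lambda>i. bit_at (R ! i)"
  interpret systematic_code l r 33 ?a
    using systematic[OF h] unfolding l_def r_def .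
  interpret shadowed_code l r 33 ?a "bit_at t"
  proof
    fix i :: nat assume i: "i < 33"
    then have "odd_overlap t (R ! i) \<noteq> divisible_by_4 (Suc (weight (R ! i)))"
      using shadow_rows length_R by (simp add: list_all_length)
    then show "(\<Sum>j<33. bit_at t j * ?a i j) = 0 \<longleftrightarrow> 4 dvd Suc (card {j. j < 33 \<and> ?a i j \<noteq> 0})"
      using i by (simp add: overlap_t divisible_by_4 weight_eq_card blen_nth del: bit_not_zero_iff)
  qed
  \<comment> \<open>Pigeonhole for the two halves, used with 5 + 4 + 1 = 10 for the code and 4 + 4 +
    1 = 9 for the shadow.\<close>
  have small: "card {i. i < 33 \<and> x $ l i \<noteq> 0} \<le> k \<or> card {j. j < 33 \<and> x $ r j \<noteq> 0} \<le> m"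
    if "hamming_weight x \<le> k + m + 1" for x :: "bit ^ 66" and k m
    using that by (auto simp: weight_split)
  interpret shadowed_code_66 l r ?a "bit_at t"
  proof
    fix x assume x: "x \<in> code" "hamming_weight x \<le> 10"
    let ?I = "{i. i < 33 \<and> x $ l i \<noteq> 0}" and ?J = "{j. j < 33 \<and> x $ r j \<noteq> 0}"
    consider "card ?I \<le> 5" | "card ?J \<le> 4"
      using small[of x 5 4] x(2) by auto
    then show "x = 0"
    proof cases
      case 1
      have "x $ r j = (\<Sum>i\<in>?I. bit_at (R ! i) j)" if "j < 33" for j
        using x(1) that unfolding code_def by (simp only: mem_Collect_eq sum_mult_support)
      then have J: "{j. j < 33 \<and> bit_at (to_bits [0..<33] 0 []) j + (\<Sum>i\<in>?I. bit_at (R ! i) j) \<noteq> 0} = ?J"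
        by auto
      have "nths [0..<33] ?I \<in> set [[]]"
        unfolding code_rows[symmetric]
        by (rule light_sums_rows[OF blen_R tag_R]) (use 1 x(2) in \<open>simp_all only: J weight_split[symmetric], auto\<close>)
      \<comment> \<open>Only the empty index list was found, so the left half vanishes, and it
        determines the codeword.\<close>
      then have I: "nths [0..<33] ?I = nths [0..<33] {}" by simp
      show ?thesis
        by (rule code_eqI[OF x(1) zero_in_code]) (use nths_upt_inj[OF I] in auto)
    next
      case 2
      have "x $ l i = (\<Sum>j\<in>?J. bit_at (Q ! j) i)" if "i < 33" for i
      proof -
        have "x $ l i = (\<Sum>j\<in>?J. bit_at (R ! i) j)"
          using x(1) that unfolding code_iff_left by (simp only: sum_mult_support)
        also have "\<dots> = (\<Sum>j\<in>?J. bit_at (Q ! j) i)"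
          using that by (intro sum.cong) (auto simp: bit_at_Q)
        finally show ?thesis .
      qed
      then have I: "{i. i < 33 \<and> bit_at (to_bits [0..<33] 0 []) i + (\<Sum>j\<in>?J. bit_at (Q ! j) i) \<noteq> 0} = ?I"
        by auto
      have "nths [0..<33] ?J \<in> set [[]]"
        unfolding code_columns[symmetric]
        by (rule light_sums_rows[OF blen_Q map_tag_columns])
          (use 2 x(2) in \<open>simp_all only: I weight_split[symmetric] add.commute[of "card ?J"], auto\<close>)
      then have J: "nths [0..<33] ?J = nths [0..<33] {}" by simp
      have "x $ r j = 0" if "j < 33" for j using nths_upt_inj[OF J] that by auto
      then show ?thesis
        by (intro code_eqI[OF x(1) zero_in_code]) (use x(1) in \<open>simp add: code_iff_left\<close>)
    qed
  qed
  \<comment> \<open>The unique shadow word with left half \<open>p\<close>.\<close>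
  define W where "W p = word (bit_at p) (bit_at (select_sum p R t))" for p
  have sel: "bit_at (select_sum p R t) j = bit_at t j + (\<Sum>i<33. bit_at p i * bit_at (R ! i) j)" if "p \<in> set P" for p j
    using bit_at_select_sum[of R t p j] that P t blen_R length_R by simp
  have bsel: "blen (select_sum p R t) = 33" for p
    using blen_select_sum[of R t p] t blen_R by simp
  have W_shadow: "W p \<in> shadow" if "p \<in> set P" for p
    using that by (simp add: shadow_iff_right W_def sel)
  have W_weight: "hamming_weight (W p) = shadow_weight R t p" if "p \<in> set P" for p
    using that P(1) by (simp add: shadow_weight_def weight_split weight_eq_card bsel W_def cong: conj_cong)
  have W_inj: "inj_on W (set P)"
  proof (rule inj_onI)
    fix p q assume pq: "p \<in> set P" "q \<in> set P" "W p = W q"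
    have "bit_at p i = bit_at q i" if "i < 33" for i
      using arg_cong[OF pq(3), of "\<lambda>v. v $ l i"] that by (simp add: W_def)
    then show "p = q" using pq P(1) by (intro bits_eqI) auto
  qed
  have light_shadow: "v \<in> W ` set P" if v: "v \<in> shadow" "hamming_weight v \<le> 9" for v
  proof -
    let ?I = "{i. i < 33 \<and> v $ l i \<noteq> 0}" and ?J = "{j. j < 33 \<and> v $ r j \<noteq> 0}"
    consider "card ?I \<le> 4" | "card ?J \<le> 4"
      using small[of v 4 4] v(2) by auto
    then show ?thesis
    proof cases
      case 1
      have "v $ r j = bit_at t j + (\<Sum>i\<in>?I. bit_at (R ! i) j)" if "j < 33" for j
        using v(1) that unfolding shadow_iff_right by (simp only: sum_mult_support)
      then have J: "{j. j < 33 \<and> bit_at t j + (\<Sum>i\<in>?I. bit_at (R ! i) j) \<noteq> 0} = ?J"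
        by auto
      have "nths [0..<33] ?I \<in> set (light_sums 4 9 (take 16 R) (drop 16 R) t (to_bits [0..<33] 0 []))"
        by (rule light_sums_rows[OF blen_R tag_R t]) (use 1 v(2) in \<open>simp_all only: J weight_split[symmetric], auto\<close>)
      then obtain p where p: "p \<in> set P" "nths [0..<33] ?I = positions p [0..<33]"
        using shadow_light_rows by (auto simp: list_all_iff)
      then have I: "nths [0..<33] ?I = nths [0..<33] {i. bit_at p i \<noteq> 0}"
        using P(1) by (simp add: positions_eq del: bit_not_zero_iff)
      have left: "v $ l i = bit_at p i" if "i < 33" for i
        using nths_upt_inj[OF I that] that by (cases "v $ l i"; cases "bit_at p i") auto
      have "v = W p"
        by (rule word_eqI) (use v(1) in \<open>simp_all add: W_def sel p shadow_iff_right left\<close>)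
      then show ?thesis using p by blast
    next
      case 2
      have "v $ l i = bit_at (overlaps t R) i + (\<Sum>j\<in>?J. bit_at (Q ! j) i)" if "i < 33" for i
      proof -
        have "v $ l i = (\<Sum>j<33. bit_at t j * bit_at (R ! i) j) + (\<Sum>j\<in>?J. bit_at (R ! i) j)"
          using v(1) that unfolding shadow_iff_left by (simp only: sum_mult_support[of "\<lambda>j. v $ r j"])
        also have "(\<Sum>j<33. bit_at t j * bit_at (R ! i) j) = bit_at (overlaps t R) i"
          using that by (simp only: overlap_t bit_at_overlaps length_R)
        also have "(\<Sum>j\<in>?J. bit_at (R ! i) j) = (\<Sum>j\<in>?J. bit_at (Q ! j) i)"
          using that by (intro sum.cong) (auto simp: bit_at_Q)
        finally show ?thesis .
      qed
      then have I: "{i. i < 33 \<and> bit_at (overlaps t R) i + (\<Sum>j\<in>?J. bit_at (Q ! j) i) \<noteq> 0} = ?I"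
        by auto
      have "nths [0..<33] ?J \<in> set (light_sums 4 9 (take 16 Q) (drop 16 Q) (overlaps t R) (to_bits [0..<33] 0 []))"
        by (rule light_sums_rows[OF blen_Q map_tag_columns])
          (use 2 v(2) in \<open>simp_all only: I weight_split[symmetric] add.commute[of "card ?J"], auto simp: length_R\<close>)
      then obtain p where p: "p \<in> set P" "nths [0..<33] ?J = positions (select_sum p R t) [0..<33]"
        using shadow_light_columns by (auto simp: list_all_iff)
      then have J: "nths [0..<33] ?J = nths [0..<33] {j. bit_at (select_sum p R t) j \<noteq> 0}"
        by (simp add: positions_eq bsel del: bit_not_zero_iff)
      have right: "v $ r j = W p $ r j" if "j < 33" for j
        using nths_upt_inj[OF J that] that by (cases "v $ r j"; cases "bit_at (select_sum p R t) j") (auto simp: W_def)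
      have "v = W p"
        by (rule word_eqI) (use v(1) W_shadow[OF p(1)] in \<open>simp_all add: shadow_iff_left right\<close>)
      then show ?thesis using p by blast
    qed
  qed
  \<comment> \<open>\<open>W\<close> is a weight-preserving injection on \<open>P\<close> that
    reaches every light shadow word, so counting is reduced to the list.\<close>
  have B_eq: "B w = length (filter (\<lambda>p. shadow_weight R t p = w) P)" if "w \<le> 9" for w
  proof -
    have "{v \<in> shadow. hamming_weight v = w} = W ` {p \<in> set P. shadow_weight R t p = w}"
    proof (intro equalityI subsetI)
      fix v assume v: "v \<in> {v \<in> shadow. hamming_weight v = w}"
      then have "v \<in> W ` set P" using that by (intro light_shadow) auto
      then obtain p where "p \<in> set P" "v = W p" by blast
      then show "v \<in> W ` {p \<in> set P. shadow_weight R t p = w}"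
        using v W_weight by auto
    qed (use W_weight W_shadow in auto)
    then have "B w = card (W ` {p \<in> set P. shadow_weight R t p = w})" by simp
    also have "\<dots> = card {p \<in> set P. shadow_weight R t p = w}"
      by (rule card_image) (rule inj_on_subset[OF W_inj], auto)
    also have "\<dots> = length (filter (\<lambda>p. shadow_weight R t p = w) P)"
      using P(2) by (simp add: distinct_card[symmetric])
    finally show ?thesis .
  qed
  have zero: "B w = 0" if "w \<le> 9" "w \<noteq> 5" "w \<noteq> 9" for w
    using that by (simp only: B_eq length_filter_shadow_weight if_False)
  have b: "B 5 = b5" "B 9 = b9" by (simp_all only: B_eq length_filter_shadow_weight) simp_all
  have a12: "int (A 12) = 858 + 112 * int b5 + 8 * int b9"
    by (rule A_12[unfolded b]) (rule zero)
  have a14: "int (A 14) = 18678 - 848 * int b5 - 24 * int b9"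
    by (rule A_14[unfolded b]) (rule zero)
  \<comment> \<open>The constant 858 is positive and the counts are not negative.\<close>
  have "A 12 \<noteq> 0" using a12 by linarith
  then obtain c where c: "c \<in> code" "hamming_weight c = 12"
    by (metis (mono_tags, lifting) card.empty empty_Collect_eq)
  have d: "min_distance code = 12"
  proof (rule min_distance_eqI)
    show "12 \<le> hamming_weight x" if "x \<in> code" "x \<noteq> 0" for x
    proof -
      have "10 < hamming_weight x" "even (hamming_weight x)"
        using light_code[of x] even_weight[of x] that by (auto simp: not_le[symmetric])
      then show ?thesis by presburger
    qed
    show "c \<noteq> 0" using c by (auto simp: hamming_weight_def)
  qed (use c code_add zero_in_code in auto)
  have "binary_code 33 12 code" "extremal_self_dual code"
    using d dim_code subspace_code self_dual_code
    by (simp_all add: binary_code_def extremal_self_dual_def extremal_distance_def)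
  then show ?thesis
    using a12 a14 by (intro exI[of _ code]) (simp add: coeff_weight_enumerator)
qed

end

text \<open>
  Bit vectors are encoded as natural numbers, the first coordinate being the least significant bit.
\<close>

fun bit_rows :: "nat list \<Rightarrow> nat list \<Rightarrow> nat list \<Rightarrow> bits list" where
  "bit_rows js (i # is) (n # ns) = to_bits js n [i] # bit_rows js is ns"
| "bit_rows js is ns = []"

lemma bit_rows_props:
  assumes "length ns = length is"
  shows "map tag (bit_rows js is ns) = map (\<lambda>i. [i]) is" "\<forall>r\<in>set (bit_rows js is ns). blen r = length js"
  using assms by (induction js "is" ns rule: bit_rows.induct) auto

section \<open>Evaluation of the certificates by rewriting\<close>

lemma upt_33: "[0..<33] = [0, 1, 2, 3, 4, 5, 6, 7, 8, 9, 10, 11, 12, 13, 14, 15, 16, 17, 18, 19, 20,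
    21, 22, 23, 24, 25, 26, 27, 28, 29, 30, 31, 32 :: nat]"
  by (simp add: upt_rec)

text \<open>Binary digits are read off the numeral itself, without evaluating divisions.\<close>

lemma to_bits_numeral:
  "to_bits (i # is) 0 l = Off (to_bits is 0 l)"
  "to_bits (i # is) 1 l = On (to_bits is 0 l)"
  "to_bits (i # is) (numeral Num.One) l = On (to_bits is 0 l)"
  "to_bits (i # is) (numeral (Num.Bit0 n)) l = Off (to_bits is (numeral n) l)"
  "to_bits (i # is) (numeral (Num.Bit1 n)) l = On (to_bits is (numeral n) l)"
  by simp_all

text \<open>The enumeration recurses on successors, so its bounds are supplied in unary.\<close>

lemma light_sums_unary:
  "light_sums 4 9 rs rs' a z =
    match_all (subset_sums [Leaf a, Empty, Empty, Empty, Empty] rs)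
      (subset_sums [Leaf z, Empty, Empty, Empty, Empty] rs')
      (Suc (Suc (Suc (Suc (Suc (Suc (Suc (Suc (Suc 0))))))))) []"
  "light_sums 4 10 rs rs' a z =
    match_all (subset_sums [Leaf a, Empty, Empty, Empty, Empty] rs)
      (subset_sums [Leaf z, Empty, Empty, Empty, Empty] rs')
      (Suc (Suc (Suc (Suc (Suc (Suc (Suc (Suc (Suc (Suc 0)))))))))) []"
  "light_sums 5 10 rs rs' a z =
    match_all (subset_sums [Leaf a, Empty, Empty, Empty, Empty, Empty] rs)
      (subset_sums [Leaf z, Empty, Empty, Empty, Empty, Empty] rs')
      (Suc (Suc (Suc (Suc (Suc (Suc (Suc (Suc (Suc (Suc 0)))))))))) []"
  by (simp_all add: light_sums_def numeral_eq_Suc)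

lemma take_drop_unary:
  "take 16 xs = take (Suc (Suc (Suc (Suc (Suc (Suc (Suc (Suc (Suc (Suc (Suc (Suc (Suc (Suc (Suc (Suc 0)))))))))))))))) xs"
  "drop 16 xs = drop (Suc (Suc (Suc (Suc (Suc (Suc (Suc (Suc (Suc (Suc (Suc (Suc (Suc (Suc (Suc (Suc 0)))))))))))))))) xs"
  by (simp_all add: numeral_eq_Suc)

lemma butlast_eval: "butlast [x] = []" "butlast (x # y # zs) = x # butlast (y # zs)"
  by auto

fun member_of :: "nat list list \<Rightarrow> nat list \<Rightarrow> bool" where
  "member_of [] x = False"
| "member_of (y # ys) x = (x = y \<or> member_of ys x)"

lemma replicate_numeral: "replicate (numeral k) x = x # replicate (pred_numeral k) x"
  by (simp add: numeral_eq_Suc)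

lemma member_of: "member_of ys x \<longleftrightarrow> x \<in> set ys"
  by (induction ys) auto

lemma sum_eval: "(0 :: nat) + n = n" "Suc m + n = Suc (m + n)"
  by simp_all

text \<open>With these equations the enumerations are carried out by the simplifier, hence through
  the kernel.\<close>

lemmas certificate_simps =
  bit_rows.simps to_bits_numeral to_bits.simps(1) upt_33 columns.simps column.simps tail.simps
  list.map append.simps take_0 drop_0 take_Nil drop_Nil take_Suc_Cons drop_Suc_Cons take_drop_unary
  odd_overlap.simps orthonormal.simps weight.simps divisible_by_4.simps overlaps.simps shadow_weight_def
  select_sum.simps positions.simps bits_xor.simps list.pred_inject distinct.simps list.set insert_iff empty_iff
  bits.inject bits.distinct simp_thms if_True if_False
  light_sums_unary trie_shift.simps fork_leaves.simps trie_insert.simps trie_merge.simps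
  add_row_aux.simps add_row.simps subset_sums.simps match_leaf.simps match_trie.simps
  match_tries.simps match_row.simps match_all.simps butlast_eval member_of.simps
  sum_eval

text \<open>Lengths and tags hold by construction from the encoded numbers; every remaining premise
  except the defining equations is a closed computation for concrete data.\<close>

lemma code_certificateI:
  assumes "length ns = 33"
    and "R = bit_rows [0..<33] [0..<33] ns"
    and "t = to_bits [0..<33] n []"
    and "P = map (\<lambda>p. to_bits [0..<33] p []) ps"
    and "distinct P"
    and "orthonormal R" "orthonormal (columns [0..<33] R)"
    and "list_all (\<lambda>r. odd_overlap t r \<noteq> divisible_by_4 (Suc (weight r))) R"
    and "map (shadow_weight R t) P = replicate b5 5 @ replicate b9 9"
    and "light_sums 5 10 (take 16 R) (drop 16 R) (to_bits [0..<33] 0 []) (to_bits [0..<33] 0 []) = [[]]"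
    and "light_sums 4 10 (take 16 (columns [0..<33] R)) (drop 16 (columns [0..<33] R))
        (to_bits [0..<33] 0 []) (to_bits [0..<33] 0 []) = [[]]"
    and "list_all (member_of (map (\<lambda>p. positions p [0..<33]) P))
        (light_sums 4 9 (take 16 R) (drop 16 R) t (to_bits [0..<33] 0 []))"
    and "list_all (member_of (map (\<lambda>p. positions (select_sum p R t) [0..<33]) P))
        (light_sums 4 9 (take 16 (columns [0..<33] R)) (drop 16 (columns [0..<33] R))
          (overlaps t R) (to_bits [0..<33] 0 []))"
  shows "code_certificate R t P b5 b9"
proof
  show "\<forall>r\<in>set R. blen r = 33" "map tag R = map (\<lambda>i. [i]) [0..<33]"
    using assms(1,2) bit_rows_props[of ns "[0..<33]" "[0..<33]"] by simp_all
  show "\<forall>p\<in>set P. blen p = 33 \<and> tag p = []" using assms(4) by auto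
qed (use assms in \<open>simp_all add: member_of[abs_def]\<close>)

subsection \<open>The codes\<close>

definition rows_13 :: "bits list" where
  "rows_13 = bit_rows [0..<33] [0..<33] [
    5151766970, 1844314462, 3688628924, 7377257848, 1550037835, 3739620832, 7479241664,
    1217130043, 7585863355, 8295112192, 8000289794, 2326184383, 6231617546, 7882037679,
    7746732074, 2825533933, 5217124526, 7851982258, 2601960157, 5638125262, 2686447004,
    1932288641, 2155591286, 870634837, 5150302309, 64336828, 5179498177, 5305890637, 513908204,
    1027685338, 2055239606, 7617992407, 8220958424]"

text \<open>The number is 2 ^ 33 - 1, so this is the all-one vector. The rows of A have odd weight,
  and accordingly every generator has weight 2 modulo 4.\<close>

definition shadow_13 :: bits where
  "shadow_13 = to_bits [0..<33] 8589934591 []"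

definition light_13 :: "bits list" where
  "light_13 = map (\<lambda>p. to_bits [0..<33] p []) [
    139270, 25266200, 33693729, 67387456, 134774913, 269549825, 302153760, 538968579, 1074020356,
    1077937156, 2155874313, 4295753760, 4311748624]"

lemma certificate_13: "code_certificate rows_13 shadow_13 light_13 0 13"
  by (rule code_certificateI[OF _ rows_13_def shadow_13_def light_13_def];
      (simp only: rows_13_def shadow_13_def light_13_def certificate_simps)?;
      (simp add: replicate_numeral)?)

definition rows_57 :: "bits list" where
  "rows_57 = bit_rows [0..<33] [0..<33] [
    8455532440, 762708046, 7198551813, 3050832184, 6101664368, 3613525216, 1496917593,
    5864297344, 5585438873, 6277582336, 4758942617, 793253785, 1184325531, 2502676381,
    3316629512, 6633127954, 3779473343, 6711113122, 3623601375, 1074779788, 6306169475,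
    4298725942, 7517294, 15034588, 29938106, 8395721965, 8335944051, 239111638, 8245752885,
    7767660739, 1912630964, 3825261928, 1073517897]"

definition shadow_57 :: bits where
  "shadow_57 = to_bits [0..<33] 134402150 []"

text \<open>The entry 0 stands for the shadow vector (0, t), which itself has weight 9.\<close>

definition light_57 :: "bits list" where
  "light_57 = map (\<lambda>p. to_bits [0..<33] p []) [
    0, 7204, 442368, 884737, 1179720, 1449988, 1638403, 1736896, 3145735, 4194304, 4923396,
    6291468, 9715723, 12582937, 19431444, 25165873, 33687561, 38862888, 45093920, 50331745,
    67375120, 77594707, 100663488, 134750240, 155189412, 201326977, 239075328, 269500480,
    310378825, 402653953, 403177476, 536879624, 539000960, 554192896, 620757649, 805307904,
    813694978, 1078001921, 1241515296, 1342318849, 1610615808, 1712340992, 2148747264,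
    2155872771, 2350908416, 2483030593, 2684637696, 3221231617, 4295122945, 4295558148,
    4296540160, 4297201760, 4297363458, 4311745540, 4966061185, 5369275392, 6442463232]"

lemma certificate_57: "code_certificate rows_57 shadow_57 light_57 0 57"
  by (rule code_certificateI[OF _ rows_57_def shadow_57_def light_57_def];
      (simp only: rows_57_def shadow_57_def light_57_def certificate_simps)?;
      (simp add: replicate_numeral)?)

section \<open>Second family: exactly one shadow word of weight 5, listed first\<close>

definition rows_24 :: "bits list" where
  "rows_24 = bit_rows [0..<33] [0..<33] [
    4998723156, 2409481208, 7964297005, 4360601725, 3936728082, 6491727217, 7510143646,
    5493452337, 4029109034, 4127820210, 3984069235, 6358883784, 922775168, 2549293558,
    2375896612, 6363440006, 337038897, 539097101, 2327509317, 4328412975, 7264862789, 7826180987,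
    594987229, 2227059264, 5275259702, 7458501768, 3124944134, 8471546959, 105395056, 6159464013,
    6862847445, 5913823468, 4189098558]"

definition shadow_24 :: bits where
  "shadow_24 = to_bits [0..<33] 5858349170 []"

definition light_24 :: "bits list" where
  "light_24 = map (\<lambda>p. to_bits [0..<33] p []) [
    4303486976, 2560, 1049600, 4194570, 17329168, 134218888, 268468224, 2147549280, 2249457664,
    2956985348, 3240136704]"

lemma certificate_24: "code_certificate rows_24 shadow_24 light_24 1 10"
  by (rule code_certificateI[OF _ rows_24_def shadow_24_def light_24_def];
      (simp only: rows_24_def shadow_24_def light_24_def certificate_simps)?;
      (simp add: replicate_numeral)?)

definition rows_25 :: "bits list" where
  "rows_25 = bit_rows [0..<33] [0..<33] [
    8331123854, 6881943827, 4311721896, 4497025823, 2385191087, 1105506615, 4456881882,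
    2564933119, 3530533017, 6725597898, 2276278370, 6021352265, 2731837406, 2297499533,
    229970172, 7863490788, 1142044570, 1727347852, 6667698551, 6119226009, 732029808, 6235652204,
    3218752739, 4142308263, 560370827, 2859964877, 6533136860, 7646365251, 3169217103,
    8355809202, 146734128, 2779805655, 6166887736]"

definition shadow_25 :: bits where
  "shadow_25 = to_bits [0..<33] 1164427741 []"

definition light_25 :: "bits list" where
  "light_25 = map (\<lambda>p. to_bits [0..<33] p []) [
    67108864, 2165252, 34738176, 56623104, 134221824, 134367248, 184549440, 537444482, 673185792,
    1073874984, 2152747014, 4295034880]"

lemma certificate_25: "code_certificate rows_25 shadow_25 light_25 1 11"
  by (rule code_certificateI[OF _ rows_25_def shadow_25_def light_25_def];
      (simp only: rows_25_def shadow_25_def light_25_def certificate_simps)?;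
      (simp add: replicate_numeral)?)

definition rows_26 :: "bits list" where
  "rows_26 = bit_rows [0..<33] [0..<33] [
    8015090236, 7367061409, 4311721896, 4237948816, 6421085216, 7272295864, 3558477031,
    6047340912, 4282508843, 6725597898, 2276278370, 5566416379, 6432495075, 6314775298,
    229970172, 152029913, 6873327015, 7437135537, 6983733189, 5395297323, 732029808, 6235652204,
    2465466961, 4403250984, 7817414660, 2270812031, 6533136860, 8236304625, 5577684672,
    800527759, 146734128, 5723302744, 2989469445]"

definition shadow_26 :: bits where
  "shadow_26 = to_bits [0..<33] 6859477984 []"

definition light_26 :: "bits list" where
  "light_26 = map (\<lambda>p. to_bits [0..<33] p []) [
    67108865, 164, 67125248, 268439632, 269124098, 402719744, 549650432, 1077936166, 2151219240,
    2214928384, 4294994056, 4559209476, 4866181120]"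

lemma certificate_26: "code_certificate rows_26 shadow_26 light_26 1 12"
  by (rule code_certificateI[OF _ rows_26_def shadow_26_def light_26_def];
      (simp only: rows_26_def shadow_26_def light_26_def certificate_simps)?;
      (simp add: replicate_numeral)?)

definition rows_27 :: "bits list" where
  "rows_27 = bit_rows [0..<33] [0..<33] [
    7116410594, 1788935580, 4311721896, 4237948816, 3599905475, 7272295864, 2710392889,
    3227047827, 4882002966, 952874025, 2276278370, 2524207046, 2731837406, 6314775298, 229970172,
    7863490788, 8258189689, 1727347852, 7882412827, 2619942422, 6501838227, 3683077775,
    3882047119, 4403250984, 2044692199, 5819942210, 759959359, 928029388, 5577684672, 8355809202,
    6989099731, 4245251515, 6166887736]"

definition shadow_27 :: bits where
  "shadow_27 = to_bits [0..<33] 1164427741 []"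

definition light_27 :: "bits list" where
  "light_27 = map (\<lambda>p. to_bits [0..<33] p []) [
    67108865, 294912, 1099328, 2646096, 4198400, 37756928, 75497730, 151666696, 269501440,
    303171840, 538214536, 2147554464, 4297346560, 4429709376]"

lemma certificate_27: "code_certificate rows_27 shadow_27 light_27 1 13"
  by (rule code_certificateI[OF _ rows_27_def shadow_27_def light_27_def];
      (simp only: rows_27_def shadow_27_def light_27_def certificate_simps)?;
      (simp add: replicate_numeral)?)

definition rows_39 :: "bits list" where
  "rows_39 = bit_rows [0..<33] [0..<33] [
    3906454118, 1095516635, 267473221, 4375368957, 8428143692, 634730303, 809103200, 1911852231,
    5988549790, 1655591614, 970380235, 7933080389, 5674658185, 6137005455, 2321546075,
    3724349238, 1198403496, 4669423133, 1200665377, 5793521064, 6043099975, 6456894314,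
    5357725750, 163718482, 8231497845, 8167901092, 6163470548, 7318579074, 2493209500,
    7101324802, 6872405575, 2199331298, 803720994]"

definition shadow_39 :: bits where
  "shadow_39 = to_bits [0..<33] 8408190288 []"

definition light_39 :: "bits list" where
  "light_39 = map (\<lambda>p. to_bits [0..<33] p []) [
    32769, 1033, 524295, 524801, 2097218, 2375744, 16777284, 34866560, 35725315, 46137866,
    71305344, 159383728, 318775296, 536920096, 537919537, 553650440, 570425872, 1078198272,
    1124073600, 2147615232, 2148020354, 2152726568, 3020947968, 4297613313, 4303360129, 4337180689]"

lemma certificate_39: "code_certificate rows_39 shadow_39 light_39 1 25"
  by (rule code_certificateI[OF _ rows_39_def shadow_39_def light_39_def];
      (simp only: rows_39_def shadow_39_def light_39_def certificate_simps)?;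
      (simp add: replicate_numeral)?)

definition rows_40 :: "bits list" where
  "rows_40 = bit_rows [0..<33] [0..<33] [
    1702162398, 6750481083, 5287838607, 4212721848, 1278849111, 7359562824, 5441373074,
    2036530734, 4742906840, 4886359304, 4646854244, 2670664952, 2066523774, 262832491,
    6097690360, 949857855, 6286135795, 354064513, 4652180377, 586982282, 4182352037, 2165784149,
    7433304330, 2950040893, 1038110230, 1163561900, 8487641792, 1814258014, 6819813526,
    3762563951, 7261676850, 4734063782, 2471421055]"

definition shadow_40 :: bits where
  "shadow_40 = to_bits [0..<33] 3663276717 []"

definition light_40 :: "bits list" where
  "light_40 = map (\<lambda>p. to_bits [0..<33] p []) [
    1074004225, 2, 8, 114696, 532617, 1048576, 2099200, 8400896, 16793731, 41975808, 67114000,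
    67193480, 67248132, 134219793, 150996017, 336592912, 537018432, 545824768, 1109393568,
    1744842754, 2147762248, 2701656705, 4429185025, 4565499909, 4567597057, 5435817984, 7524581392]"

lemma certificate_40: "code_certificate rows_40 shadow_40 light_40 1 26"
  by (rule code_certificateI[OF _ rows_40_def shadow_40_def light_40_def];
      (simp only: rows_40_def shadow_40_def light_40_def certificate_simps)?;
      (simp add: replicate_numeral)?)

definition rows_41 :: "bits list" where
  "rows_41 = bit_rows [0..<33] [0..<33] [
    3468395272, 8441611620, 5877984336, 4212721848, 692936584, 7359562824, 5441373074,
    3084483879, 4742906840, 8279846401, 7956782445, 1368694769, 2066523774, 1792962228,
    7076371953, 1575567840, 8009137445, 3201692759, 7491407695, 3964084355, 2621263738,
    718819971, 7433304330, 68772331, 4082879775, 2346780837, 8487641792, 1814258014, 5784312735,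
    1267419065, 7261676850, 4734063782, 4130999200]"

definition shadow_41 :: bits where
  "shadow_41 = to_bits [0..<33] 350398884 []"

definition light_41 :: "bits list" where
  "light_41 = map (\<lambda>p. to_bits [0..<33] p []) [
    1074004224, 9, 114697, 532617, 8400896, 8462984, 16793730, 41975809, 46399632, 67129874,
    134219792, 150996017, 336592912, 436207664, 537018432, 539689984, 541196544, 545824768,
    1095237632, 1358991376, 1644167232, 1880096784, 2147491904, 2214592848, 2701656704,
    4429185025, 4565499909, 4567597056]"

lemma certificate_41: "code_certificate rows_41 shadow_41 light_41 1 27"
  by (rule code_certificateI[OF _ rows_41_def shadow_41_def light_41_def];
      (simp only: rows_41_def shadow_41_def light_41_def certificate_simps)?;
      (simp add: replicate_numeral)?)

definition rows_42 :: "bits list" where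
  "rows_42 = bit_rows [0..<33] [0..<33] [
    1309181604, 8441611620, 4568804085, 4212721848, 1732630829, 7359562824, 4468786487,
    929724555, 4742906840, 4886359304, 4646854244, 3509033565, 891560155, 618063889, 4923840605,
    1575567840, 4628037164, 1046934011, 6178098246, 1827939631, 2621263738, 3831746954,
    8405893039, 2225759303, 1944635571, 1163561900, 8487641792, 1814258014, 7926619699,
    3409461781, 7261676850, 5706650115, 3090320645]"

definition shadow_42 :: bits where
  "shadow_42 = to_bits [0..<33] 3663276717 []"

definition light_42 :: "bits list" where
  "light_42 = map (\<lambda>p. to_bits [0..<33] p []) [
    1074004224, 8, 8450, 114697, 532617, 790020, 1065472, 2670656, 8400897, 16793731, 35651712,
    41975809, 100731168, 134219792, 150996016, 268566820, 318832656, 336592912, 537018432,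
    537137680, 545824768, 553811968, 1073873920, 2701656705, 4311810112, 4429185025, 4565499909,
    4567597057, 4580182020]"

lemma certificate_42: "code_certificate rows_42 shadow_42 light_42 1 28"
  by (rule code_certificateI[OF _ rows_42_def shadow_42_def light_42_def];
      (simp only: rows_42_def shadow_42_def light_42_def certificate_simps)?;
      (simp add: replicate_numeral)?)

section \<open>Comparison with the prescribed weight enumerators\<close>

lemma has_W66_1_exists:
  assumes "code_certificate R t P 0 b"
  shows "\<exists>C :: (bit ^ 66) set. binary_code 33 12 C \<and> extremal_self_dual C \<and> has_W66_1 (int b) C"
  using code_certificate.code_exists[OF assms] by (simp add: has_W66_1_def)

text \<open>One shadow word of weight 5 adds 112 = 8 * 14 to the first coefficient, and 18678 - 848
  = 18166 - 24 * 14 in the second. Hence \<beta> exceeds the number of shadow words of weight 9 by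
  14.\<close>

lemma has_W66_3_exists:
  assumes "code_certificate R t P 1 b"
  shows "\<exists>C :: (bit ^ 66) set. binary_code 33 12 C \<and> extremal_self_dual C \<and> has_W66_3 (int b + 14) C"
  using code_certificate.code_exists[OF assms] by (simp add: has_W66_3_def algebra_simps)

theorem mainTheorem2:
  shows "(\<forall>\<beta>\<in>{13, 57}. \<exists>C :: (bit ^ 66) set.
            binary_code 33 12 C \<and> extremal_self_dual C \<and> has_W66_1 \<beta> C) \<and>
         (\<forall>\<beta>\<in>{24, 25, 26, 27, 39, 40, 41, 42}. \<exists>C :: (bit ^ 66) set.
            binary_code 33 12 C \<and> extremal_self_dual C \<and> has_W66_3 \<beta> C)"
  using has_W66_1_exists[OF certificate_13] has_W66_1_exists[OF certificate_57]
    has_W66_3_exists[OF certificate_24] has_W66_3_exists[OF certificate_25]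
    has_W66_3_exists[OF certificate_26] has_W66_3_exists[OF certificate_27]
    has_W66_3_exists[OF certificate_39] has_W66_3_exists[OF certificate_40]
    has_W66_3_exists[OF certificate_41] has_W66_3_exists[OF certificate_42]
  by simp

end
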